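(* Consider one step, from time level $l$ to time level $l+1$, of the scheme (S) described in the context. Assume that for every $m=1,\dots,M$, $c^{m,l}\in\mathcal{C}_{\mathrm{per}}$ and $c^{m,l}>0$ at every grid point, with $\|c^{m,l}\|_\infty\le M_1$ for some $M_1>0$ (so that $c^{m,l}\ge C_0^{m,l}:=\min_{1\le i,j,k\le N}c^{m,l}_{i,j,k}>0$), and that $\overline{\rho_h^f}+\sum_{m=1}^Mz^m\overline{c^{m,l}}=0$. Then there exists a unique solution $c^{m,l+1}\in\mathcal{C}_{\mathrm{per}}$, $m=1,\dots,M$, to the nonlinear scheme (S), with $c^{m,l+1}>0$ at every grid point.
   Context: Grid and periodic functions. $\Omega=[a,b]^3$, $N$ is a positive integer, $h=(b-a)/N$, and grid points are $x_i=a+(i-\frac12)h$, $y_j=a+(j-\frac12)h$, $z_k=a+(k-\frac12)h$. $\mathcal{C}_{\mathrm{per}}$ is the space of real grid functions $v=(v_{i,j,k})_{i,j,k\in\mathbb{Z}}$ that are $N$-periodic in each index: $v_{i,j,k}=v_{i+\alpha N,j+\beta N,k+\gamma N}$ for all integers $\alpha,\beta,\gamma$. The average of $v$ is $\overline{v}=\frac{h^3}{|\Omega|}\sum_{i,j,k=1}^N v_{i,j,k}$, and $\|v\|_\infty=\max_{1\le i,j,k\le N}|v_{i,j,k}|$. Face-centered periodic functions in the $x$-direction have values $f_{i+\frac12,j,k}$ and are $N$-periodic in each index; similarly in the $y$- and $z$-directions. Difference operators. $D_xv_{i+\frac12,j,k}=\frac1h(v_{i+1,j,k}-v_{i,j,k})$,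 $A_xv_{i+\frac12,j,k}=\frac12(v_{i+1,j,k}+v_{i,j,k})$, and for face functions $d_xf_{i,j,k}=\frac1h(f_{i+\frac12,j,k}-f_{i-\frac12,j,k})$; $D_y,D_z,A_y,A_z,d_y,d_z$ are analogous. For $v\in\mathcal{C}_{\mathrm{per}}$ and a periodic coefficient $\mathcal{D}$ given at the face points, $\nabla_h\cdot(\mathcal{D}\nabla_hv)_{i,j,k}=d_x(\mathcal{D}D_xv)_{i,j,k}+d_y(\mathcal{D}D_yv)_{i,j,k}+d_z(\mathcal{D}D_zv)_{i,j,k}$, and $\Delta_h v=\nabla_h\cdot(\nabla_h v)$ (the case $\mathcal{D}\equiv1$). Parameters. $M\ge1$ is the number of ionic species; $z^m\in\mathbb{R}$ are valences; $\epsilon^m>0$; $\sigma^m>0$ are gradient energy coefficients; $\kappa$ is a periodic coefficient function with $\kappa\ge\kappa_0>0$; $G=(g^{mn})$ is a symmetric $M\times M$ matrix with non-negative entries, and $G=G_c-G_e$ where $G_c=(g_c^{mn})$ and $G_e=(g_e^{mn})$ are positive semi-definite (symmetric) matrices; $\rho_h^f\in\mathcal{C}_{\mathrm{per}}$ is the fixed charge density. The time step $\Delta t>0$ is arbitrary. Scheme (S). Given $c^{m,l}\in\mathcal{C}_{\mathrm{per}}$, $m=1,\dots,M$, find $c^{m,l+1}\in\mathcal{C}_{\mathrm{per}}$, together with $\mu^{m,l+1},\psi^{l+1}\in\mathcal{C}_{\mathrm{per}}$, such that for $m=1,\dots,M$ $$\frac{c^{m,l+1}-c^{m,l}}{\Delta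 t}=\epsilon^m\nabla_h\cdot\left(\check c^{m,l}\nabla_h\mu^{m,l+1}\right),$$ $$\mu^{m,l+1}=z^m\psi^{l+1}+\log c^{m,l+1}+\sum_{n=1}^Mg_c^{mn}c^{n,l+1}-\sigma^m\Delta_hc^{m,l+1}-\sum_{n=1}^Mg_e^{mn}c^{n,l},$$ $$-\nabla_h\cdot(\kappa\nabla_h\psi^{l+1})=\sum_{m=1}^Mz^mc^{m,l+1}+\rho_h^f,$$ where the mobilities at face points are $\check c^{m,l}_{i+\frac12,j,k}=A_xc^{m,l}_{i+\frac12,j,k}$, $\check c^{m,l}_{i,j+\frac12,k}=A_yc^{m,l}_{i,j+\frac12,k}$, $\check c^{m,l}_{i,j,k+\frac12}=A_zc^{m,l}_{i,j,k+\frac12}$. A solution requires $c^{m,l+1}>0$ for the logarithm to be defined. The potential is normalized by $\overline{\psi^{l+1}}=0$ (it is otherwise determined only up to an additive constant, which does not affect the equations for $c^{m,l+1}$). *)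

theory Defs
  imports "HOL-Analysis.Analysis"
begin

text \<open>
  Grid functions carry their integer indices.  The same type serves for cell-centred functions
  \<open>v\<^sub>i\<^sub>j\<^sub>k\<close> and for face-centred ones: a face function in the \<open>x\<close>-direction has
  \<open>f i j k\<close> as its value at the face point \<open>(i + 1/2, j, k)\<close>, one in the \<open>y\<close>-direction at
  \<open>(i, j + 1/2, k)\<close>, and one in the \<open>z\<close>-direction at \<open>(i, j, k + 1/2)\<close>.
\<close>

type_synonym grid = "int \<Rightarrow> int \<Rightarrow> int \<Rightarrow> real"

definition C_per :: "nat \<Rightarrow> grid set" where
  "C_per N = {v. \<forall>i j k \<alpha> \<beta> \<gamma>. v i j k = v (i + \<alpha> * int N) (j + \<beta> * int N) (k + \<gamma> * int N)}"

definition mesh_size :: "real \<Rightarrow> real \<Rightarrow> nat \<Rightarrow> real" where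
  "mesh_size a b N = (b - a) / real N"

text \<open>The denominator is the volume of the cube \<open>[a,b]\<^sup>3\<close>.\<close>

definition grid_avg :: "real \<Rightarrow> real \<Rightarrow> nat \<Rightarrow> grid \<Rightarrow> real" where
  "grid_avg a b N v =
     (mesh_size a b N)^3 / (b - a)^3 * (\<Sum>i=1..int N. \<Sum>j=1..int N. \<Sum>k=1..int N. v i j k)"

definition grid_max_norm :: "nat \<Rightarrow> grid \<Rightarrow> real" where
  "grid_max_norm N v = Max {\<bar>v i j k\<bar> | i j k. i \<in> {1..int N} \<and> j \<in> {1..int N} \<and> k \<in> {1..int N}}"

definition D_x :: "real \<Rightarrow> grid \<Rightarrow> grid" where
  "D_x h v i j k = (v (i + 1) j k - v i j k) / h"

definition D_y :: "real \<Rightarrow> grid \<Rightarrow> grid" where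
  "D_y h v i j k = (v i (j + 1) k - v i j k) / h"

definition D_z :: "real \<Rightarrow> grid \<Rightarrow> grid" where
  "D_z h v i j k = (v i j (k + 1) - v i j k) / h"

definition A_x :: "grid \<Rightarrow> grid" where
  "A_x v i j k = (v (i + 1) j k + v i j k) / 2"

definition A_y :: "grid \<Rightarrow> grid" where
  "A_y v i j k = (v i (j + 1) k + v i j k) / 2"

definition A_z :: "grid \<Rightarrow> grid" where
  "A_z v i j k = (v i j (k + 1) + v i j k) / 2"

text \<open>
  The operators \<open>d_x\<close>, \<open>d_y\<close>, \<open>d_z\<close> act on face functions, so by the indexing convention the value
  at the face \<open>i - 1/2\<close> is found at index \<open>i - 1\<close>.
\<close>

definition d_x :: "real \<Rightarrow> grid \<Rightarrow> grid" where
  "d_x h f i j k = (f i j k - f (i - 1) j k) / h"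

definition d_y :: "real \<Rightarrow> grid \<Rightarrow> grid" where
  "d_y h f i j k = (f i j k - f i (j - 1) k) / h"

definition d_z :: "real \<Rightarrow> grid \<Rightarrow> grid" where
  "d_z h f i j k = (f i j k - f i j (k - 1)) / h"

text \<open>
  The operator \<open>\<nabla>\<^sub>h \<cdot> (\<D> \<nabla>\<^sub>h v)\<close>; the coefficient \<open>\<D>\<close> is given by its values \<open>p\<close>, \<open>q\<close>, \<open>r\<close> at the
  face points in the \<open>x\<close>-, \<open>y\<close>- and \<open>z\<close>-direction.
\<close>

definition div_grad :: "real \<Rightarrow> grid \<Rightarrow> grid \<Rightarrow> grid \<Rightarrow> grid \<Rightarrow> grid" where
  "div_grad h p q r v i j k =
     d_x h (\<lambda>i j k. p i j k * D_x h v i j k) i j k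
   + d_y h (\<lambda>i j k. q i j k * D_y h v i j k) i j k
   + d_z h (\<lambda>i j k. r i j k * D_z h v i j k) i j k"

definition laplace :: "real \<Rightarrow> grid \<Rightarrow> grid" where
  "laplace h v = div_grad h (\<lambda>_ _ _. 1) (\<lambda>_ _ _. 1) (\<lambda>_ _ _. 1) v"

definition psd_matrix :: "real^'m^'m \<Rightarrow> bool" where
  "psd_matrix A \<longleftrightarrow> transpose A = A \<and> (\<forall>x. 0 \<le> x \<bullet> (A *v x))"

text \<open>
  One step of the scheme, from \<open>c\<^sub>0\<close> to \<open>c\<close>; the species are the elements of the finite type \<open>'m\<close>.
  Positivity of \<open>c\<close> belongs to the notion of solution: the function \<^const>\<open>ln\<close> is total, so
  the equations alone would not enforce it.  The coefficient \<open>\<kappa>\<close> is given by its face values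
  \<open>\<kappa>x\<close>, \<open>\<kappa>y\<close>, \<open>\<kappa>z\<close>.
\<close>

definition scheme_solution ::
  "real \<Rightarrow> real \<Rightarrow> nat \<Rightarrow> real \<Rightarrow> ('m \<Rightarrow> real) \<Rightarrow> ('m \<Rightarrow> real) \<Rightarrow> ('m \<Rightarrow> real) \<Rightarrow>
   grid \<Rightarrow> grid \<Rightarrow> grid \<Rightarrow> real^'m^'m \<Rightarrow> real^'m^'m \<Rightarrow> grid \<Rightarrow>
   ('m::finite \<Rightarrow> grid) \<Rightarrow> ('m \<Rightarrow> grid) \<Rightarrow> ('m \<Rightarrow> grid) \<Rightarrow> grid \<Rightarrow> bool" where
  "scheme_solution a b N \<Delta>t z \<epsilon> \<sigma> \<kappa>x \<kappa>y \<kappa>z Gc Ge \<rho> c\<^sub>0 c \<mu> \<psi> \<longleftrightarrow>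
     (let h = mesh_size a b N in
        (\<forall>m. c m \<in> C_per N) \<and> (\<forall>m. \<mu> m \<in> C_per N) \<and> \<psi> \<in> C_per N
      \<and> (\<forall>m i j k. c m i j k > 0)
      \<and> grid_avg a b N \<psi> = 0
      \<and> (\<forall>m i j k. (c m i j k - c\<^sub>0 m i j k) / \<Delta>t
            = \<epsilon> m * div_grad h (A_x (c\<^sub>0 m)) (A_y (c\<^sub>0 m)) (A_z (c\<^sub>0 m)) (\<mu> m) i j k)
      \<and> (\<forall>m i j k. \<mu> m i j k
            = z m * \<psi> i j k + ln (c m i j k) + (\<Sum>n\<in>UNIV. Gc $ m $ n * c n i j k)
              - \<sigma> m * laplace h (c m) i j k - (\<Sum>n\<in>UNIV. Ge $ m $ n * c\<^sub>0 n i j k))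
      \<and> (\<forall>i j k. - div_grad h \<kappa>x \<kappa>y \<kappa>z \<psi> i j k = (\<Sum>m\<in>UNIV. z m * c m i j k) + \<rho> i j k))"

end

theory Submission
  imports Defs "HOL-Real_Asymp.Real_Asymp"
begin

text \<open>
  On one period the scheme is the Euler--Lagrange system of the convex functional
  \[ \sum_m \frac{1}{2 \Delta t\, \epsilon^m} \langle c^m - c^{m,l}, B_m (c^m - c^{m,l}) \rangle
     + \sum_m \langle c^m, \ln c^m - 1 \rangle + \frac12 \langle c, (G_c - \sigma \Delta_h) c \rangle
     + \frac12 \langle q, T q \rangle - \langle G_e c^l, c \rangle, \qquad q = \sum_m z^m c^m + \rho, \]
  over nonnegative \<open>c\<close> with the masses of \<open>c\<^sub>0\<close>, where \<open>B\<^sub>m\<close> and \<open>T\<close> invert the mobility and Poisson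
  operators on functions of mean zero. The feasible set is compact, and the infinite slope of
  \<open>c ln c\<close> at \<open>0\<close> keeps minimizers in the interior, where the multiplier of the mass constraint is
  absorbed by the constant that the mobility operator does not see. Uniqueness is monotonicity: pairing
  the difference of the two \<open>c\<close> with the difference of the two \<open>\<mu>\<close> gives a nonpositive number by the
  evolution equation, but a positive one by the formula for \<open>\<mu>\<close>, since \<open>ln\<close> is strictly increasing
  and all the other terms are positive semidefinite.
\<close>

section \<open>Matrices on finite sets\<close>

text \<open>Induction on the index set, passing to the Schur complement of one diagonal entry.\<close>

lemma positive_system_solvable:
  fixes a :: "'i \<Rightarrow> 'i \<Rightarrow> real"
  assumes "finite I"
    and "\<And>x. \<exists>i\<in>I. x i \<noteq> 0 \<Longrightarrow> (\<Sum>i\<in>I. x i * (\<Sum>j\<in>I. a i j * x j)) > 0"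
  shows "\<exists>x. \<forall>i\<in>I. (\<Sum>j\<in>I. a i j * x j) = q i"
  using assms
proof (induction I arbitrary: a q rule: finite_induct)
  case empty
  then show ?case by simp
next
  case (insert k I)
  have eqk: "(\<Sum>j\<in>I. w j * (if j = k then s else x j)) = (\<Sum>j\<in>I. w j * x j)"
    for w x :: "'i \<Rightarrow> real" and s
    using insert(2) by (intro sum.cong) auto
  have akk: "a k k > 0"
  proof -
    define e :: "'i \<Rightarrow> real" where "e j = (if j = k then 1 else 0)" for j
    have "e i = 0" if "i \<in> I" for i
      using that insert(2) by (auto simp: e_def)
    then have "(\<Sum>i\<in>insert k I. e i * (\<Sum>j\<in>insert k I. a i j * e j)) = a k k"
      using insert(1,2) by (simp add: e_def[of k])
    then show ?thesis
      using insert(4)[of e] by (auto simp: e_def)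
  qed
  define a' where "a' i j = a i j - a i k * a k j / a k k" for i j
  define q' where "q' i = q i - a i k * q k / a k k" for i
  \<comment> \<open>\<open>lift s x\<close> completes \<open>x\<close> by the entry at
    \<open>k\<close> that makes row \<open>k\<close> equal to \<open>s\<close>. With
    \<open>s = 0\<close> the form of \<open>a\<close> at the lifted vector becomes that of the Schur
    complement \<open>a'\<close> at \<open>x\<close>; with \<open>s = q k\<close> a solution of the
    reduced system becomes one of the full system.\<close>
  define lift where "lift s x j = (if j = k then (s - (\<Sum>j\<in>I. a k j * x j)) / a k k else x j)"
    for s and x :: "'i \<Rightarrow> real" and j
  have row: "(\<Sum>j\<in>insert k I. a i j * lift s x j) = (\<Sum>j\<in>I. a' i j * x j) + a i k * s / a k k"
    for i s x
  proof -
    have "(\<Sum>j\<in>I. a' i j * x j) = (\<Sum>j\<in>I. a i j * x j) - a i k / a k k * (\<Sum>j\<in>I. a k j * x j)"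
      by (simp add: a'_def algebra_simps sum_subtractf sum_distrib_left)
    then show ?thesis
      using insert(1,2) akk by (simp add: lift_def eqk field_simps)
  qed
  have rowk: "(\<Sum>j\<in>insert k I. a k j * lift s x j) = s" for s x
    using insert(1,2) akk by (simp add: lift_def eqk)
  have "(\<Sum>i\<in>I. x i * (\<Sum>j\<in>I. a' i j * x j)) > 0" if "\<exists>i\<in>I. x i \<noteq> 0" for x
  proof -
    have "\<exists>i\<in>insert k I. lift 0 x i \<noteq> 0"
      using that insert(2) by (auto simp: lift_def)
    from insert(4)[OF this]
    have "(\<Sum>i\<in>I. lift 0 x i * (\<Sum>j\<in>insert k I. a i j * lift 0 x j)) > 0"
      using insert(1,2) by (simp only: sum.insert[OF insert(1,2), of "\<lambda>i. lift 0 x i * _ i"] rowk)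
    moreover have "(\<Sum>i\<in>I. lift 0 x i * (\<Sum>j\<in>I. a' i j * x j))
        = (\<Sum>i\<in>I. x i * (\<Sum>j\<in>I. a' i j * x j))"
      using insert(2) by (intro sum.cong) (auto simp: lift_def)
    ultimately show ?thesis
      by (simp add: row)
  qed
  then obtain x where x: "\<forall>i\<in>I. (\<Sum>j\<in>I. a' i j * x j) = q' i"
    using insert(3)[of a' q'] by blast
  have "\<forall>i\<in>insert k I. (\<Sum>j\<in>insert k I. a i j * lift (q k) x j) = q i"
    using x rowk[of "q k" x] row[of _ "q k" x] by (auto simp: q'_def)
  then show ?case by blast
qed

section \<open>Minimizing entropy plus a quadratic form under mass constraints\<close>

text \<open>Continuity at \<open>0\<close> is the point: \<open>x * ln x\<close> tends to
  \<open>0\<close> from the right, which agrees with the value that the factor \<open>0\<close>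
  forces there.\<close>

lemma continuous_on_x_ln_x: "continuous_on {0..} (\<lambda>x::real. x * ln x)"
  unfolding continuous_on_def
proof
  fix x :: real assume "x \<in> {0..}"
  show "((\<lambda>x. x * ln x) \<longlongrightarrow> x * ln x) (at x within {0..})"
  proof (cases "x = 0")
    case True
    have "((\<lambda>x::real. x * ln x) \<longlongrightarrow> 0) (at_right 0)"
      by real_asymp
    then show ?thesis using True by (simp add: at_within_Ici_at_right)
  next
    case False
    then show ?thesis by (intro tendsto_intros) auto
  qed
qed

text \<open>Tychonoff's theorem in the function space with its product topology. It lets the
  minimization run over plain functions on an arbitrary index type.\<close>

lemma compact_box_fun:
  fixes S :: "'i \<Rightarrow> 'a::topological_space set"
  assumes "\<And>i. compact (S i)"
  shows "compact {f. \<forall>i. f i \<in> S i}"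
proof -
  have "compactin (product_topology (\<lambda>i. euclidean) UNIV) (PiE UNIV S)"
    using assms by (subst compactin_PiE) (auto simp: compactin_euclidean_iff)
  moreover have "PiE UNIV S = {f. \<forall>i. f i \<in> S i}" by auto
  ultimately show ?thesis
    by (simp add: euclidean_product_topology compactin_euclidean_iff)
qed

text \<open>A minimizer exists by compactness; moving mass \<open>t\<close> between two entries of the same class shows
  that it is positive, because the slope of \<open>t ln t\<close> at \<open>0\<close> is \<open>-\<infinity>\<close>, and gives the stationarity
  condition.\<close>

lemma entropy_minimizer:
  fixes h :: "'i \<Rightarrow> 'i \<Rightarrow> real" and l c\<^sub>0 :: "'i \<Rightarrow> real" and g :: "'i \<Rightarrow> 'g"
  assumes fin: "finite I"
    and sym: "\<And>i j. i \<in> I \<Longrightarrow> j \<in> I \<Longrightarrow> h i j = h j i"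
    and pos: "\<And>i. i \<in> I \<Longrightarrow> c\<^sub>0 i > 0"
  shows "\<exists>c. (\<forall>i\<in>I. c i > 0) \<and>
    (\<forall>m. (\<Sum>i | i \<in> I \<and> g i = m. c i) = (\<Sum>i | i \<in> I \<and> g i = m. c\<^sub>0 i)) \<and>
    (\<forall>i\<in>I. \<forall>j\<in>I. g i = g j \<longrightarrow>
      ln (c i) + (\<Sum>k\<in>I. h i k * c k) + l i = ln (c j) + (\<Sum>k\<in>I. h j k * c k) + l j)"
proof -
  let ?s = "\<lambda>c m. \<Sum>i | i \<in> I \<and> g i = m. c i"
  \<comment> \<open>Indices outside \<open>I\<close> are pinned to \<open>0\<close>, since free
    coordinates there would destroy compactness.\<close>
  define D where "D = {c. (\<forall>i. if i \<in> I then 0 \<le> c i else c i = 0) \<and> (\<forall>m. ?s c m = ?s c\<^sub>0 m)}"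
  define Q where "Q x = (\<Sum>i\<in>I. x i * (\<Sum>j\<in>I. h i j * x j))" for x
  define \<phi> :: "real \<Rightarrow> real" where "\<phi> x = x * ln x - x" for x
  define F where "F c = (\<Sum>i\<in>I. \<phi> (c i)) + Q c / 2 + (\<Sum>i\<in>I. c i * l i)" for c
  have D_le: "c i \<le> ?s c\<^sub>0 (g i)" if "c \<in> D" "i \<in> I" for c i
  proof -
    have "c i \<le> ?s c (g i)"
      using that fin by (intro member_le_sum) (auto simp: D_def)
    then show ?thesis using that by (simp add: D_def)
  qed
  \<comment> \<open>The mass of a class bounds each of its nonnegative members, so the feasible set
    is a box cut by closed linear constraints.\<close>
  have "D = {c. \<forall>i. c i \<in> (if i \<in> I then {0..?s c\<^sub>0 (g i)} else {0})} \<inter> (\<Inter>m. {c. ?s c m = ?s c\<^sub>0 m})"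
    (is "D = ?B \<inter> ?C")
    using D_le by (auto simp: D_def split: if_splits)
  moreover have "compact ?B"
    by (rule compact_box_fun) auto
  moreover have "closed ?C"
    by (intro closed_INT ballI closed_Collect_eq continuous_on_sum continuous_on_const
        continuous_on_product_coordinates)
  ultimately have "compact D"
    by (simp add: compact_Int_closed)
  moreover have "(\<lambda>i. if i \<in> I then c\<^sub>0 i else 0) \<in> D"
    using pos by (auto simp: D_def less_imp_le intro!: sum.cong)
  moreover have "continuous_on D F"
  proof -
    have coord: "continuous_on D (\<lambda>c. c i)" for i
      by (rule continuous_on_product_then_coordinatewise) (rule continuous_on_id)
    have "continuous_on D (\<lambda>c. \<phi> (c i))" if "i \<in> I" for i
      unfolding \<phi>_def
      by (rule continuous_on_diff[OF continuous_on_compose2[OF continuous_on_x_ln_x coord] coord])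
         (use that in \<open>force simp: D_def\<close>)
    with coord show ?thesis
      unfolding F_def Q_def
      by (intro continuous_on_add continuous_on_sum continuous_on_mult
          continuous_on_divide continuous_on_const) auto
  qed
  ultimately obtain c where cD: "c \<in> D" and cmin: "\<And>d. d \<in> D \<Longrightarrow> F c \<le> F d"
    using continuous_attains_inf[of D F] by blast
  define G where "G i = (\<Sum>k\<in>I. h i k * c k) + l i" for i
  \<comment> \<open>Minimality of \<open>c\<close> tested against the transfer of \<open>t\<close>
    from \<open>j\<close> to \<open>i\<close>, which preserves the class sums. \<open>G\<close> is
    the gradient of the quadratic and linear parts, and \<beta> will be half the quadratic form in
    the direction of the transfer. The amount \<open>t\<close> may have either sign.\<close>
  have exch: "\<exists>\<beta>. \<forall>t. 0 \<le> c i + t \<longrightarrow> t \<le> c j \<longrightarrow>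
      \<phi> (c i) + \<phi> (c j) \<le> \<phi> (c i + t) + \<phi> (c j - t) + t * (G i - G j) + t\<^sup>2 * \<beta>"
    if ij: "i \<in> I" "j \<in> I" "g i = g j" "i \<noteq> j" for i j
  proof -
    define y :: "'i \<Rightarrow> real" where "y k = of_bool (k = i) - of_bool (k = j)" for k
    have sumy: "(\<Sum>k\<in>I. y k * f k) = f i - f j" for f
    proof -
      have "(\<Sum>k\<in>I. y k * f k) = (\<Sum>k\<in>{i, j}. y k * f k)"
        using ij fin by (intro sum.mono_neutral_right) (auto simp: y_def)
      then show ?thesis using ij by (simp add: y_def)
    qed
    have "\<phi> (c i) + \<phi> (c j) \<le> \<phi> (c i + t) + \<phi> (c j - t) + t * (G i - G j) + t\<^sup>2 * (Q y / 2)"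
      if t: "0 \<le> c i + t" "t \<le> c j" for t
    proof -
      define d where "d k = c k + t * y k" for k
      have "?s d m = ?s c m" for m
      proof -
        have "?s d m = ?s c m + t * (\<Sum>k | k \<in> I \<and> g k = m. y k)"
          by (simp add: d_def sum.distrib sum_distrib_left)
        also have "(\<Sum>k | k \<in> I \<and> g k = m. y k) = (\<Sum>k\<in>I. y k * of_bool (g k = m))"
          using fin by (intro sum.mono_neutral_cong_left) auto
        also have "\<dots> = 0" using sumy[of "\<lambda>k. of_bool (g k = m)"] ij by simp
        finally show ?thesis by simp
      qed
      moreover have "0 \<le> d k" if "k \<in> I" for k
        using that cD t by (auto simp: d_def y_def D_def)
      moreover have "d k = 0" if "k \<notin> I" for k
        using that cD ij by (auto simp: d_def y_def D_def)
      ultimately have "d \<in> D" using cD by (simp add: D_def)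
      then have "F c \<le> F d" by (rule cmin)
      moreover have "Q d = Q c + 2 * (t * (G i - l i - (G j - l j))) + t\<^sup>2 * Q y"
      proof -
        have "(\<Sum>k\<in>I. c k * (\<Sum>n\<in>I. h k n * y n)) = (\<Sum>n\<in>I. \<Sum>k\<in>I. c k * (h k n * y n))"
          by (subst sum.swap) (simp add: sum_distrib_left)
        also have "\<dots> = (\<Sum>k\<in>I. y k * (\<Sum>n\<in>I. h k n * c n))"
          by (intro sum.cong refl) (simp add: sum_distrib_left sym mult_ac)
        finally have cross: "(\<Sum>k\<in>I. c k * (\<Sum>n\<in>I. h k n * y n)) = \<dots>" .
        define H where "H v k = (\<Sum>n\<in>I. h k n * v n)" for v k
        have "H d k = H c k + t * H y k" for k
          by (simp add: H_def d_def distrib_left sum.distrib sum_distrib_left mult_ac)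
        then have "Q d = (\<Sum>k\<in>I. d k * (H c k + t * H y k))"
          by (simp add: Q_def H_def[symmetric])
        also have "\<dots> = (\<Sum>k\<in>I. (c k + t * y k) * (H c k + t * H y k))"
          by (simp add: d_def)
        also have "\<dots> = (\<Sum>k\<in>I. c k * H c k) + t * (\<Sum>k\<in>I. c k * H y k)
            + t * (\<Sum>k\<in>I. y k * H c k) + t\<^sup>2 * (\<Sum>k\<in>I. y k * H y k)"
          by (simp add: algebra_simps sum.distrib sum_distrib_left power2_eq_square)
        finally show ?thesis
          using cross sumy[of "H c"] by (simp add: Q_def H_def G_def)
      qed
      moreover have "(\<Sum>k\<in>I. d k * l k) = (\<Sum>k\<in>I. c k * l k) + t * (l i - l j)"
        unfolding sumy[of l, symmetric]
        by (simp add: d_def distrib_right sum.distrib sum_distrib_left mult.assoc)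
      moreover have "(\<Sum>k\<in>I. \<phi> (d k)) - (\<Sum>k\<in>I. \<phi> (c k))
          = \<phi> (c i + t) - \<phi> (c i) + (\<phi> (c j - t) - \<phi> (c j))"
      proof -
        have "(\<Sum>k\<in>I. \<phi> (d k)) - (\<Sum>k\<in>I. \<phi> (c k)) = (\<Sum>k\<in>I. \<phi> (d k) - \<phi> (c k))"
          by (simp add: sum_subtractf)
        also have "\<dots> = (\<Sum>k\<in>{i, j}. \<phi> (d k) - \<phi> (c k))"
          using ij fin by (intro sum.mono_neutral_right) (auto simp: d_def y_def)
        also have "\<dots> = \<phi> (c i + t) - \<phi> (c i) + (\<phi> (c j - t) - \<phi> (c j))"
          using ij by (simp add: d_def y_def)
        finally show ?thesis .
      qed
      ultimately show ?thesis
        by (simp add: F_def right_diff_distrib) argo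
    qed
    then show ?thesis by blast
  qed
  have nn: "0 \<le> c i" if "i \<in> I" for i
    using that cD by (auto simp: D_def)
  have cpos: "c i > 0" if i: "i \<in> I" for i
  proof (rule ccontr)
    assume "\<not> c i > 0"
    with nn[OF i] have ci: "c i = 0" by simp
    \<comment> \<open>The class of \<open>i\<close> has positive total mass, so another member
      \<open>j\<close> has mass to hand over to \<open>i\<close>.\<close>
    have "0 < ?s c\<^sub>0 (g i)"
      using i fin pos by (intro sum_pos) auto
    then have "?s c (g i) \<noteq> 0"
      using cD by (simp add: D_def)
    then obtain j where j: "j \<in> I" "g j = g i" "c j \<noteq> 0"
      using sum.neutral[of "{k. k \<in> I \<and> g k = g i}" c] by blast
    then have cj: "c j > 0" using nn[of j] by simp
    obtain \<beta> where \<beta>: "\<forall>t. 0 \<le> c i + t \<longrightarrow> t \<le> c j \<longrightarrow>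
      \<phi> (c i) + \<phi> (c j) \<le> \<phi> (c i + t) + \<phi> (c j - t) + t * (G i - G j) + t\<^sup>2 * \<beta>"
      using exch[of i j] i j ci by auto
    \<comment> \<open>As \<open>t\<close> decreases to \<open>0\<close>, \<open>t * ln t\<close>
      outweighs every term of order \<open>t\<close>, so the transfer would strictly lower the
      functional, against minimality.\<close>
    have "eventually (\<lambda>t. (t * ln t - t) + ((c j - t) * ln (c j - t) - (c j - t)) + t * (G i - G j)
        + t\<^sup>2 * \<beta> < c j * ln (c j) - c j) (at_right 0)"
      using cj by real_asymp
    moreover have "eventually (\<lambda>t. t \<in> {0<..<c j}) (at_right 0)"
      using cj by (rule eventually_at_right_real)
    ultimately have "eventually (\<lambda>t::real. False) (at_right 0)"
    proof eventually_elim
      case (elim t)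
      with \<beta>[rule_format, of t] show ?case by (simp add: ci \<phi>_def)
    qed
    then show False by simp
  qed
  have EL: "ln (c i) + G i = ln (c j) + G j" if ij: "i \<in> I" "j \<in> I" "g i = g j" for i j
  proof (cases "i = j")
    case False
    with exch[OF ij] obtain \<beta> where \<beta>: "\<forall>t. 0 \<le> c i + t \<longrightarrow> t \<le> c j \<longrightarrow>
      \<phi> (c i) + \<phi> (c j) \<le> \<phi> (c i + t) + \<phi> (c j - t) + t * (G i - G j) + t\<^sup>2 * \<beta>" by blast
    \<comment> \<open>With both entries positive, small \<open>t\<close> of either sign is
      admissible, so \<open>0\<close> is a local minimum of \<open>?f\<close> and the derivative
      vanishes there.\<close>
    let ?f = "\<lambda>t. \<phi> (c i + t) + \<phi> (c j - t) + t * (G i - G j) + t\<^sup>2 * \<beta>"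
    have "(?f has_real_derivative ln (c i) - ln (c j) + (G i - G j)) (at 0)"
    proof -
      have D: "((\<lambda>t. \<phi> (s + r * t)) has_real_derivative r * ln s) (at 0)" if "s > 0" for s r
        unfolding \<phi>_def by (rule derivative_eq_intros refl | use that in \<open>simp add: field_simps\<close>)+
      show ?thesis
        using D[OF cpos[OF ij(1)], of 1] D[OF cpos[OF ij(2)], of "-1"]
        by (auto intro!: derivative_eq_intros)
    qed
    moreover have "\<forall>t. \<bar>0 - t\<bar> < min (c i) (c j) \<longrightarrow> ?f 0 \<le> ?f t"
      using \<beta> by auto
    ultimately have "ln (c i) - ln (c j) + (G i - G j) = 0"
      using cpos ij by (intro DERIV_local_min[of ?f _ 0 "min (c i) (c j)"]) auto
    then show ?thesis by simp
  qed simp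
  show ?thesis
  proof (intro exI[of _ c] conjI ballI allI impI)
    show "?s c m = ?s c\<^sub>0 m" for m
      using cD unfolding D_def by blast
    show "ln (c i) + (\<Sum>k\<in>I. h i k * c k) + l i = ln (c j) + (\<Sum>k\<in>I. h j k * c k) + l j"
      if "i \<in> I" "j \<in> I" "g i = g j" for i j
      using EL[OF that] unfolding G_def by (simp only: add.assoc)
  qed (fact cpos)
qed

section \<open>Operators as matrices on a finite set, and Green matrices\<close>

definition mat_app :: "'p set \<Rightarrow> ('p \<Rightarrow> 'p \<Rightarrow> real) \<Rightarrow> ('p \<Rightarrow> real) \<Rightarrow> 'p \<Rightarrow> real" where
  "mat_app Q a u x = (\<Sum>y\<in>Q. a x y * u y)"

definition ip :: "'p set \<Rightarrow> ('p \<Rightarrow> real) \<Rightarrow> ('p \<Rightarrow> real) \<Rightarrow> real" where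
  "ip Q u v = (\<Sum>x\<in>Q. u x * v x)"

text \<open>The properties of the matrix of \<open>v \<mapsto> -\<nabla>\<^sub>h \<cdot> (\<D> \<nabla>\<^sub>h v)\<close> with positive \<open>\<D>\<close> on the
  periodic grid that the argument uses; the last one says that its kernel consists of constants.\<close>

definition laplacian_like :: "'p set \<Rightarrow> ('p \<Rightarrow> 'p \<Rightarrow> real) \<Rightarrow> bool" where
  "laplacian_like Q a \<longleftrightarrow>
     (\<forall>x\<in>Q. \<forall>y\<in>Q. a x y = a y x) \<and> (\<forall>x\<in>Q. (\<Sum>y\<in>Q. a x y) = 0) \<and>
     (\<forall>u. 0 \<le> ip Q u (mat_app Q a u)) \<and>
     (\<forall>u. ip Q u (mat_app Q a u) = 0 \<longrightarrow> (\<forall>x\<in>Q. \<forall>y\<in>Q. u x = u y))"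

lemma mat_app_add: "mat_app Q a (\<lambda>x. u x + v x) x = mat_app Q a u x + mat_app Q a v x"
  by (simp add: mat_app_def distrib_left sum.distrib)

lemma mat_app_diff: "mat_app Q a (\<lambda>x. u x - v x) x = mat_app Q a u x - mat_app Q a v x"
  by (simp add: mat_app_def right_diff_distrib sum_subtractf)

lemma mat_app_cmult: "mat_app Q a (\<lambda>x. r * u x) x = r * mat_app Q a u x"
  by (simp add: mat_app_def sum_distrib_left mult_ac)

lemma ip_mat_app:
  assumes "\<And>x y. x \<in> Q \<Longrightarrow> y \<in> Q \<Longrightarrow> a x y = a y x"
  shows "ip Q u (mat_app Q a v) = ip Q (mat_app Q a u) v"
proof -
  have "ip Q u (mat_app Q a v) = (\<Sum>y\<in>Q. \<Sum>x\<in>Q. u x * (a x y * v y))"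
    unfolding ip_def mat_app_def by (subst sum.swap) (simp add: sum_distrib_left)
  also have "\<dots> = ip Q (mat_app Q a u) v"
    unfolding ip_def mat_app_def by (auto simp: sum_distrib_right sum_distrib_left assms mult_ac intro!: sum.cong)
  finally show ?thesis .
qed

lemma laplacian_like_app_const:
  assumes "laplacian_like Q a" "x \<in> Q"
  shows "mat_app Q a (\<lambda>_. r) x = 0"
proof -
  have "mat_app Q a (\<lambda>_. r) x = (\<Sum>y\<in>Q. a x y) * r"
    by (simp add: mat_app_def sum_distrib_right)
  moreover have "(\<Sum>y\<in>Q. a x y) = 0"
    using assms unfolding laplacian_like_def by blast
  ultimately show ?thesis by simp
qed

text \<open>Symmetry moves the operator onto the constant \<open>1\<close>, which it annihilates;
  this is discrete conservation of mass.\<close>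

lemma laplacian_like_sum_app:
  assumes "laplacian_like Q a"
  shows "(\<Sum>x\<in>Q. mat_app Q a u x) = 0"
proof -
  have "(\<Sum>x\<in>Q. mat_app Q a u x) = ip Q (\<lambda>_. 1) (mat_app Q a u)"
    by (simp add: ip_def)
  also have "\<dots> = ip Q (mat_app Q a (\<lambda>_. 1)) u"
    using assms by (intro ip_mat_app) (auto simp: laplacian_like_def)
  also have "\<dots> = 0"
    by (simp add: ip_def laplacian_like_app_const[OF assms])
  finally show ?thesis .
qed

text \<open>Adding the all-ones matrix makes \<open>a\<close> positive definite without changing its action on
  functions of mean zero, so the Green matrix is the inverse of that sum.\<close>

lemma green_matrix_exists:
  fixes Q :: "'p set"
  assumes fin: "finite Q" and ne: "Q \<noteq> {}" and lap: "laplacian_like Q a"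
  obtains g where "\<And>x y. x \<in> Q \<Longrightarrow> y \<in> Q \<Longrightarrow> g x y = g y x"
    and "\<And>f x. (\<Sum>y\<in>Q. f y) = 0 \<Longrightarrow> x \<in> Q \<Longrightarrow> mat_app Q a (mat_app Q g f) x = f x"
    and "\<And>f. (\<Sum>y\<in>Q. f y) = 0 \<Longrightarrow> (\<Sum>x\<in>Q. mat_app Q g f x) = 0"
proof -
  define a' where "a' x y = a x y + 1" for x y
  have app': "mat_app Q a' u x = mat_app Q a u x + sum u Q" for u x
    by (simp add: mat_app_def a'_def distrib_right sum.distrib)
  have sym': "a' x y = a' y x" if "x \<in> Q" "y \<in> Q" for x y
    using lap that by (simp add: a'_def laplacian_like_def)
  have card: "card Q \<noteq> 0" using fin ne by simp
  have pd: "ip Q u (mat_app Q a' u) > 0" if u: "\<exists>x\<in>Q. u x \<noteq> 0" for u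
  proof -
    have eq: "ip Q u (mat_app Q a' u) = ip Q u (mat_app Q a u) + (sum u Q)\<^sup>2"
      by (simp add: ip_def app' distrib_left sum.distrib power2_eq_square flip: sum_distrib_right)
    have nn: "0 \<le> ip Q u (mat_app Q a u)" using lap by (simp add: laplacian_like_def)
    have "ip Q u (mat_app Q a u) \<noteq> 0 \<or> sum u Q \<noteq> 0"
    proof (rule ccontr)
      assume "\<not> ?thesis"
      then have z: "ip Q u (mat_app Q a u) = 0" "sum u Q = 0" by auto
      obtain x where x: "x \<in> Q" "u x \<noteq> 0" using u by blast
      have "\<forall>y\<in>Q. u y = u x" using lap z(1) x(1) by (auto simp: laplacian_like_def)
      then have "sum u Q = card Q * u x" by simp
      then show False using z(2) card x(2) by simp
    qed
    then show ?thesis using nn unfolding eq by (smt (verit) zero_less_power2 zero_le_power2)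
  qed
  \<comment> \<open>The vector \<open>w z\<close> solves for the point mass at \<open>z\<close>;
    these vectors become the columns of the Green matrix.\<close>
  have "\<exists>w. \<forall>x\<in>Q. (\<Sum>y\<in>Q. a' x y * w y) = of_bool (x = z)" for z
    by (rule positive_system_solvable[OF fin pd[unfolded ip_def mat_app_def]])
  then obtain w where w: "\<And>z x. x \<in> Q \<Longrightarrow> mat_app Q a' (w z) x = of_bool (x = z)"
    unfolding mat_app_def by metis
  define g where "g x z = w z x" for x z
  have ip_ind: "ip Q u (\<lambda>x. of_bool (x = z)) = u z" if "z \<in> Q" for u z
    using that fin by (simp add: ip_def of_bool_def if_distrib cong: if_cong)
  have ip_ind': "ip Q (\<lambda>x. of_bool (x = z)) u = u z" if "z \<in> Q" for u z
    using ip_ind[OF that, of u] by (simp add: ip_def mult.commute)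
  have gsym: "g x y = g y x" if "x \<in> Q" "y \<in> Q" for x y
  proof -
    \<comment> \<open>The inverse of a symmetric matrix is symmetric: both \<open>w x y\<close> and
      \<open>w y x\<close> are the pairing of \<open>w x\<close> with \<open>w y\<close> under
      \<open>a'\<close>.\<close>
    have "w x y = ip Q (w x) (mat_app Q a' (w y))"
      using ip_ind[OF that(2), of "w x"] by (simp add: ip_def w)
    also have "\<dots> = ip Q (mat_app Q a' (w x)) (w y)"
      by (rule ip_mat_app) (rule sym')
    also have "\<dots> = w y x"
      using ip_ind'[OF that(1), of "w y"] by (simp add: ip_def w)
    finally show ?thesis by (simp add: g_def)
  qed
  have inv: "mat_app Q a' (mat_app Q g f) x = f x" if "x \<in> Q" for f x
  proof -
    have "mat_app Q a' (mat_app Q g f) x = (\<Sum>z\<in>Q. \<Sum>y\<in>Q. a' x y * (w z y * f z))"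
      unfolding mat_app_def g_def by (subst sum.swap) (simp add: sum_distrib_left)
    also have "\<dots> = (\<Sum>z\<in>Q. mat_app Q a' (w z) x * f z)"
      by (simp add: mat_app_def sum_distrib_left sum_distrib_right mult_ac)
    also have "\<dots> = ip Q (\<lambda>z. of_bool (z = x)) f"
      using that by (simp add: w ip_def eq_commute)
    finally show ?thesis using ip_ind'[OF that] by simp
  qed
  have mean: "(\<Sum>x\<in>Q. mat_app Q g f x) = 0" if f: "(\<Sum>y\<in>Q. f y) = 0" for f
  proof -
    \<comment> \<open>Summing over \<open>Q\<close> removes the part coming from \<open>a\<close>
      and leaves the added all-ones matrix, which multiplies the total by
      \<open>card Q\<close>.\<close>
    have "0 = (\<Sum>x\<in>Q. mat_app Q a' (mat_app Q g f) x)"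
      using f inv by simp
    also have "\<dots> = card Q * (\<Sum>x\<in>Q. mat_app Q g f x)"
      by (simp add: app' sum.distrib laplacian_like_sum_app[OF lap])
    finally show ?thesis using card by simp
  qed
  show ?thesis
  proof (rule that[OF gsym _ mean])
    fix f :: "'p \<Rightarrow> real" and x assume "(\<Sum>y\<in>Q. f y) = 0" "x \<in> Q"
    then show "mat_app Q a (mat_app Q g f) x = f x"
      using inv[of x f] mean[of f] by (simp add: app')
  qed
qed

text \<open>The scheme on the finite set of grid points of one period: \<open>a m\<close> and \<open>k\<close> stand for the
  negated mobility and Poisson operators, \<open>l m\<close> for \<open>-\<sigma>\<^sup>m \<Delta>\<^sub>h\<close>, \<open>\<tau> m\<close> for \<open>\<Delta>t \<epsilon>\<^sup>m\<close> and \<open>f m\<close> for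
  the explicit term with \<open>G\<^sub>e\<close>.\<close>

definition discrete_solution where
  "discrete_solution Q a k l gc z \<tau> f \<rho> c\<^sub>0 c \<mu> \<psi> \<longleftrightarrow>
     (\<forall>m. \<forall>x\<in>Q. c m x > 0) \<and> (\<Sum>x\<in>Q. \<psi> x) = 0 \<and>
     (\<forall>m. \<forall>x\<in>Q. c m x - c\<^sub>0 m x = - \<tau> m * mat_app Q (a m) (\<mu> m) x) \<and>
     (\<forall>m. \<forall>x\<in>Q. \<mu> m x = z m * \<psi> x + ln (c m x) + (\<Sum>n\<in>UNIV. gc m n * c n x)
        + mat_app Q (l m) (c m) x - f m x) \<and>
     (\<forall>x\<in>Q. mat_app Q k \<psi> x = (\<Sum>m\<in>UNIV. z m * c m x) + \<rho> x)"
  for c :: "'m::finite \<Rightarrow> 'p \<Rightarrow> real"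

section \<open>Existence and uniqueness on one period\<close>

text \<open>The minimizer is taken over pairs of a species and a point, with the species as class.
  The potential is then obtained from the charge by the Green matrix \<open>T\<close>, \<mu> is
  defined by its formula, and stationarity turns into the evolution equation.\<close>

lemma discrete_solution_exists:
  fixes a l :: "'m::finite \<Rightarrow> 'p \<Rightarrow> 'p \<Rightarrow> real"
  assumes fin: "finite Q" and ne: "Q \<noteq> {}"
    and a: "\<And>m. laplacian_like Q (a m)" and k: "laplacian_like Q k"
    and l: "\<And>m x y. x \<in> Q \<Longrightarrow> y \<in> Q \<Longrightarrow> l m x y = l m y x"
    and gc: "\<And>m n. gc m n = gc n m" and \<tau>: "\<And>m. \<tau> m > 0"
    and c\<^sub>0: "\<And>m x. x \<in> Q \<Longrightarrow> c\<^sub>0 m x > 0"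
    and neutral: "(\<Sum>x\<in>Q. \<rho> x) + (\<Sum>m\<in>UNIV. z m * (\<Sum>x\<in>Q. c\<^sub>0 m x)) = 0"
  shows "\<exists>c \<mu> \<psi>. discrete_solution Q a k l gc z \<tau> f \<rho> c\<^sub>0 c \<mu> \<psi>"
proof -
  define green where "green a g \<longleftrightarrow> (\<forall>x\<in>Q. \<forall>y\<in>Q. g x y = g y x) \<and>
      (\<forall>f. (\<Sum>y\<in>Q. f y) = 0 \<longrightarrow> (\<forall>x\<in>Q. mat_app Q a (mat_app Q g f) x = f x) \<and>
        (\<Sum>x\<in>Q. mat_app Q g f x) = 0)" for a g
  have green_ex: "\<exists>g. green a g" if lap: "laplacian_like Q a" for a
    by (rule green_matrix_exists[OF fin ne lap]) (unfold green_def, blast)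
  then have "\<forall>m. \<exists>g. green (a m) g"
    using a by blast
  then obtain B where B': "\<And>m. green (a m) (B m)"
    by metis
  have Bsym: "B m x y = B m y x" if "x \<in> Q" "y \<in> Q" for m x y
    using B'[of m] that unfolding green_def by blast
  have B: "mat_app Q (a m) (mat_app Q (B m) f) x = f x" if "(\<Sum>y\<in>Q. f y) = 0" "x \<in> Q" for m f x
    using B'[of m] that unfolding green_def by blast
  obtain T where T': "green k T"
    using green_ex[OF k] by blast
  have Tsym: "T x y = T y x" if "x \<in> Q" "y \<in> Q" for x y
    using T' that unfolding green_def by blast
  have T: "mat_app Q k (mat_app Q T f) x = f x" if "(\<Sum>y\<in>Q. f y) = 0" "x \<in> Q" for f x
    using T' that unfolding green_def by blast
  have Tmean: "(\<Sum>x\<in>Q. mat_app Q T f x) = 0" if "(\<Sum>y\<in>Q. f y) = 0" for f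
    using T' that unfolding green_def by blast
  \<comment> \<open>The Hessian of the quadratic part of the functional: the evolution and gradient
    energies stay within one species, \<open>gc\<close> couples species at one point, and the
    electrostatic term couples everything.\<close>
  define h where "h = (\<lambda>(m, x) (n, y). (if m = n then B m x y / \<tau> m + l m x y else 0)
      + ((if x = y then gc m n else 0) + z m * z n * T x y))"
  \<comment> \<open>The linear terms: the potential of the fixed charge, the cross term of the
    evolution energy with the old concentration, and the explicit term.\<close>
  define b where "b = (\<lambda>(m, x). z m * mat_app Q T \<rho> x - mat_app Q (B m) (c\<^sub>0 m) x / \<tau> m - f m x)"
  have finI: "finite ((UNIV :: 'm set) \<times> Q)" using fin by simp
  have symh: "h i j = h j i" if "i \<in> UNIV \<times> Q" "j \<in> UNIV \<times> Q" for i j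
  proof -
    obtain m x n y where ij: "i = (m, x)" "j = (n, y)"
      by (meson surj_pair)
    with that have xy: "x \<in> Q" "y \<in> Q" by auto
    show ?thesis
      using Bsym[OF xy, of m] l[OF xy, of m] Tsym[OF xy] gc[of m n]
      unfolding h_def ij(1,2) prod.case by auto
  qed
  let ?I = "(UNIV :: 'm set) \<times> Q" and ?c\<^sub>0 = "\<lambda>(m, x). c\<^sub>0 m x"
  have c\<^sub>0': "?c\<^sub>0 i > 0" if "i \<in> ?I" for i
    using that c\<^sub>0 by auto
  have "\<exists>d. (\<forall>i\<in>?I. d i > 0) \<and> (\<forall>m. (\<Sum>i | i \<in> ?I \<and> fst i = m. d i) = (\<Sum>i | i \<in> ?I \<and> fst i = m. ?c\<^sub>0 i)) \<and>
      (\<forall>i\<in>?I. \<forall>j\<in>?I. fst i = fst j \<longrightarrow>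
        ln (d i) + (\<Sum>k\<in>?I. h i k * d k) + b i = ln (d j) + (\<Sum>k\<in>?I. h j k * d k) + b j)"
    by (rule entropy_minimizer[OF finI]) (fact symh, fact c\<^sub>0')
  then obtain d where d: "\<forall>i\<in>?I. d i > 0"
      "\<forall>m. (\<Sum>i | i \<in> ?I \<and> fst i = m. d i) = (\<Sum>i | i \<in> ?I \<and> fst i = m. ?c\<^sub>0 i)"
      "\<forall>i\<in>?I. \<forall>j\<in>?I. fst i = fst j \<longrightarrow>
        ln (d i) + (\<Sum>k\<in>?I. h i k * d k) + b i = ln (d j) + (\<Sum>k\<in>?I. h j k * d k) + b j"
    by (elim exE conjE) (rule that)
  define c where "c m x = d (m, x)" for m x
  have mass: "(\<Sum>x\<in>Q. c m x) = (\<Sum>x\<in>Q. c\<^sub>0 m x)" for m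
  proof -
    have "{i. i \<in> UNIV \<times> Q \<and> fst i = m} = Pair m ` Q" by auto
    then show ?thesis using d(2)[rule_format, of m] by (simp add: c_def sum.reindex inj_on_def)
  qed
  have hd: "(\<Sum>k\<in>UNIV \<times> Q. h (m, x) k * d k) = mat_app Q (B m) (c m) x / \<tau> m + mat_app Q (l m) (c m) x
      + (\<Sum>n\<in>UNIV. gc m n * c n x) + z m * mat_app Q T (\<lambda>y. \<Sum>n\<in>UNIV. z n * c n y) x"
    if x: "x \<in> Q" for m x
  proof -
    have "(\<Sum>k\<in>UNIV \<times> Q. h (m, x) k * d k) = (\<Sum>n\<in>UNIV. \<Sum>y\<in>Q. h (m, x) (n, y) * c n y)"
      by (simp add: c_def sum.cartesian_product case_prod_beta')
    also have "\<dots> = (\<Sum>n\<in>UNIV. (if m = n then mat_app Q (B m) (c m) x / \<tau> m + mat_app Q (l m) (c m) x else 0)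
        + (gc m n * c n x + z m * (\<Sum>y\<in>Q. T x y * (z n * c n y))))"
    proof (rule sum.cong[OF refl])
      fix n
      have "(\<Sum>y\<in>Q. (if x = y then gc m n else 0) * c n y) = (\<Sum>y\<in>Q. if x = y then gc m n * c n y else 0)"
        by (rule sum.cong) auto
      also have "\<dots> = gc m n * c n x" using x fin by simp
      finally have 1: "(\<Sum>y\<in>Q. (if x = y then gc m n else 0) * c n y) = gc m n * c n x" .
      have 2: "(\<Sum>y\<in>Q. (if m = n then B m x y / \<tau> m + l m x y else 0) * c n y)
        = (if m = n then mat_app Q (B m) (c m) x / \<tau> m + mat_app Q (l m) (c m) x else 0)"
        by (auto simp: mat_app_def distrib_right sum.distrib sum_divide_distrib)
      have 3: "(\<Sum>y\<in>Q. z m * z n * T x y * c n y) = z m * (\<Sum>y\<in>Q. T x y * (z n * c n y))"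
        by (simp add: sum_distrib_left mult_ac)
      show "(\<Sum>y\<in>Q. h (m, x) (n, y) * c n y) = (if m = n then mat_app Q (B m) (c m) x / \<tau> m + mat_app Q (l m) (c m) x else 0)
        + (gc m n * c n x + z m * (\<Sum>y\<in>Q. T x y * (z n * c n y)))"
        unfolding 1[symmetric] 2[symmetric] 3[symmetric]
        by (simp only: h_def prod.case distrib_right sum.distrib)
    qed
    also have "\<dots> = mat_app Q (B m) (c m) x / \<tau> m + mat_app Q (l m) (c m) x
      + (\<Sum>n\<in>UNIV. gc m n * c n x) + z m * (\<Sum>n\<in>UNIV. \<Sum>y\<in>Q. T x y * (z n * c n y))"
      by (simp add: sum.distrib sum_distrib_left)
    also have "(\<Sum>n\<in>UNIV. \<Sum>y\<in>Q. T x y * (z n * c n y)) = mat_app Q T (\<lambda>y. \<Sum>n\<in>UNIV. z n * c n y) x"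
      unfolding mat_app_def by (subst sum.swap) (simp add: sum_distrib_left)
    finally show ?thesis .
  qed
  define q where "q x = (\<Sum>m\<in>UNIV. z m * c m x) + \<rho> x" for x
  define \<psi> where "\<psi> = mat_app Q T q"
  define \<mu> where "\<mu> m x = z m * \<psi> x + ln (c m x) + (\<Sum>n\<in>UNIV. gc m n * c n x)
        + mat_app Q (l m) (c m) x - f m x" for m x
  \<comment> \<open>Electroneutrality of the old data carries over because each species keeps its
    mass; mean zero is what \<open>T\<close> needs in order to solve the Poisson equation.\<close>
  have q0: "(\<Sum>x\<in>Q. q x) = 0"
  proof -
    have "(\<Sum>x\<in>Q. \<Sum>m\<in>UNIV. z m * c m x) = (\<Sum>m\<in>UNIV. z m * (\<Sum>x\<in>Q. c m x))"
      by (subst sum.swap) (simp add: sum_distrib_left)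
    then show ?thesis using neutral by (simp add: q_def sum.distrib mass)
  qed
  define w where "w m = mat_app Q (B m) (\<lambda>x. c m x - c\<^sub>0 m x)" for m
  \<comment> \<open>The gradient of the functional differs from \<mu> only by the contribution
    \<open>w m x / \<tau> m\<close> of the evolution energy.\<close>
  have \<mu>: "\<mu> m x = ln (d (m, x)) + (\<Sum>k\<in>UNIV \<times> Q. h (m, x) k * d k) + b (m, x) - w m x / \<tau> m"
    if "x \<in> Q" for m x
    unfolding \<mu>_def hd[OF that] \<psi>_def q_def b_def w_def mat_app_add mat_app_diff prod.case c_def[symmetric]
    by (simp add: algebra_simps diff_divide_distrib)
  have "c m x - c\<^sub>0 m x = - \<tau> m * mat_app Q (a m) (\<mu> m) x" if x: "x \<in> Q" for m x
  proof -
    \<comment> \<open>By stationarity \<open>s\<close> is the same at all points for the given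
      species: it is the Lagrange multiplier of the mass constraint. The operator \<open>a m\<close>
      annihilates it and turns \<open>w m\<close> back into
      \<open>c m x - c\<^sub>0 m x\<close>.\<close>
    define s where "s = ln (d (m, x)) + (\<Sum>k\<in>UNIV \<times> Q. h (m, x) k * d k) + b (m, x)"
    have "\<mu> m y = s - (1 / \<tau> m) * w m y" if "y \<in> Q" for y
    proof -
      have "s = ln (d (m, y)) + (\<Sum>k\<in>?I. h (m, y) k * d k) + b (m, y)"
        unfolding s_def by (rule d(3)[rule_format]) (use x that in simp_all)
      then show ?thesis
        unfolding \<mu>[OF that] by simp
    qed
    then have "mat_app Q (a m) (\<mu> m) x = mat_app Q (a m) (\<lambda>y. s - (1 / \<tau> m) * w m y) x"
      by (simp add: mat_app_def)
    also have "\<dots> = - (1 / \<tau> m) * mat_app Q (a m) (w m) x"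
      by (simp only: mat_app_diff mat_app_cmult laplacian_like_app_const[OF a x])
    also have "mat_app Q (a m) (w m) x = c m x - c\<^sub>0 m x"
      unfolding w_def using x by (intro B) (simp_all add: sum_subtractf mass)
    finally show ?thesis using \<tau>[of m] by (simp add: field_simps)
  qed
  moreover have "mat_app Q k \<psi> x = q x" if "x \<in> Q" for x
    unfolding \<psi>_def by (rule T[OF q0 that])
  moreover have "(\<Sum>x\<in>Q. \<psi> x) = 0"
    unfolding \<psi>_def by (rule Tmean[OF q0])
  moreover have "c m x > 0" if "x \<in> Q" for m x
    using d(1)[rule_format, of "(m, x)"] that by (simp add: c_def)
  ultimately have "discrete_solution Q a k l gc z \<tau> f \<rho> c\<^sub>0 c \<mu> \<psi>"
    unfolding discrete_solution_def \<mu>_def q_def by simp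
  then show ?thesis by blast
qed

lemma ln_diff_mult_pos:
  fixes x y :: real
  assumes "x > 0" "y > 0" "x \<noteq> y"
  shows "(x - y) * (ln x - ln y) > 0"
  using assms by (cases x y rule: linorder_cases) (auto intro: mult_neg_neg)

text \<open>The matrices contribute only signs; the strict inequality that rules out two solutions
  comes from the logarithm alone.\<close>

lemma discrete_solution_unique:
  fixes a l :: "'m::finite \<Rightarrow> 'p \<Rightarrow> 'p \<Rightarrow> real"
  assumes fin: "finite Q"
    and a: "\<And>m u. 0 \<le> ip Q u (mat_app Q (a m) u)" and k: "\<And>u. 0 \<le> ip Q u (mat_app Q k u)"
    and l: "\<And>m u. 0 \<le> ip Q u (mat_app Q (l m) u)"
    and gc: "\<And>u. 0 \<le> (\<Sum>m\<in>UNIV. u m * (\<Sum>n\<in>UNIV. gc m n * u n))" and \<tau>: "\<And>m. \<tau> m > 0"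
    and sol: "discrete_solution Q a k l gc z \<tau> f \<rho> c\<^sub>0 c \<mu> \<psi>"
    and sol': "discrete_solution Q a k l gc z \<tau> f \<rho> c\<^sub>0 c' \<mu>' \<psi>'"
    and x: "x \<in> Q"
  shows "c m x = c' m x"
proof (rule ccontr)
  assume neq: "c m x \<noteq> c' m x"
  define d where "d m x = c m x - c' m x" for m x
  define e where "e m x = \<mu> m x - \<mu>' m x" for m x
  define p where "p x = \<psi> x - \<psi>' x" for x
  define L where "L m x = ln (c m x) - ln (c' m x)" for m x
  have d: "d m x = - \<tau> m * mat_app Q (a m) (e m) x" if "x \<in> Q" for m x
  proof -
    have "c m x - c\<^sub>0 m x = - \<tau> m * mat_app Q (a m) (\<mu> m) x"
      "c' m x - c\<^sub>0 m x = - \<tau> m * mat_app Q (a m) (\<mu>' m) x"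
      using sol sol' that unfolding discrete_solution_def by blast+
    then show ?thesis
      unfolding d_def e_def mat_app_diff by (simp add: algebra_simps)
  qed
  have e: "e m x = z m * p x + L m x + (\<Sum>n\<in>UNIV. gc m n * d n x) + mat_app Q (l m) (d m) x"
    if "x \<in> Q" for m x
  proof -
    have "\<mu> m x = z m * \<psi> x + ln (c m x) + (\<Sum>n\<in>UNIV. gc m n * c n x) + mat_app Q (l m) (c m) x - f m x"
      "\<mu>' m x = z m * \<psi>' x + ln (c' m x) + (\<Sum>n\<in>UNIV. gc m n * c' n x) + mat_app Q (l m) (c' m) x - f m x"
      using sol sol' that unfolding discrete_solution_def by blast+
    then show ?thesis
      unfolding d_def e_def mat_app_diff p_def L_def by (simp add: algebra_simps sum_subtractf)
  qed
  have p: "mat_app Q k p x = (\<Sum>m\<in>UNIV. z m * d m x)" if "x \<in> Q" for x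
  proof -
    have "mat_app Q k \<psi> x = (\<Sum>m\<in>UNIV. z m * c m x) + \<rho> x"
      "mat_app Q k \<psi>' x = (\<Sum>m\<in>UNIV. z m * c' m x) + \<rho> x"
      using sol sol' that unfolding discrete_solution_def by blast+
    then show ?thesis
      unfolding d_def p_def mat_app_diff by (simp add: right_diff_distrib sum_subtractf)
  qed
  \<comment> \<open>The evolution equation replaces \<open>d m\<close> by \<open>- \<tau> m\<close>
    times the mobility operator applied to \<open>e m\<close>, which leaves a nonpositive
    dissipation term.\<close>
  have "(\<Sum>m\<in>UNIV. ip Q (d m) (e m)) = (\<Sum>m\<in>UNIV. - \<tau> m * ip Q (e m) (mat_app Q (a m) (e m)))"
    by (intro sum.cong refl) (simp add: ip_def d sum_distrib_left sum_negf mult_ac)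
  also have "\<dots> \<le> 0"
    using a \<tau> by (intro sum_nonpos) (simp add: less_imp_le)
  finally have "(\<Sum>m\<in>UNIV. ip Q (d m) (e m)) \<le> 0" .
  \<comment> \<open>Inserting the formula for \<open>e\<close>: the electrostatic terms add up to
    the Poisson form of \<open>p\<close>, because the difference of the charges is the Poisson
    operator applied to \<open>p\<close>.\<close>
  moreover have "(\<Sum>m\<in>UNIV. ip Q (d m) (e m)) = ip Q p (mat_app Q k p) + (\<Sum>m\<in>UNIV. ip Q (d m) (L m))
      + (\<Sum>x\<in>Q. \<Sum>m\<in>UNIV. d m x * (\<Sum>n\<in>UNIV. gc m n * d n x)) + (\<Sum>m\<in>UNIV. ip Q (d m) (mat_app Q (l m) (d m)))"
  proof -
    have "ip Q p (mat_app Q k p) = (\<Sum>m\<in>UNIV. \<Sum>x\<in>Q. d m x * (z m * p x))"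
      unfolding ip_def by (subst sum.swap) (simp add: p sum_distrib_left mult_ac)
    moreover have "(\<Sum>x\<in>Q. \<Sum>m\<in>UNIV. d m x * (\<Sum>n\<in>UNIV. gc m n * d n x))
        = (\<Sum>m\<in>UNIV. \<Sum>x\<in>Q. d m x * (\<Sum>n\<in>UNIV. gc m n * d n x))"
      by (rule sum.swap)
    moreover have "(\<Sum>m\<in>UNIV. ip Q (d m) (e m)) = (\<Sum>m\<in>UNIV. \<Sum>x\<in>Q. d m x * (z m * p x + L m x
        + (\<Sum>n\<in>UNIV. gc m n * d n x) + mat_app Q (l m) (d m) x))"
      by (simp add: ip_def e)
    ultimately show ?thesis
      by (simp add: ip_def distrib_left sum.distrib)
  qed
  moreover have "0 \<le> ip Q p (mat_app Q k p)" by (rule k)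
  moreover have "0 \<le> (\<Sum>x\<in>Q. \<Sum>m\<in>UNIV. d m x * (\<Sum>n\<in>UNIV. gc m n * d n x))"
    by (intro sum_nonneg gc)
  moreover have "0 \<le> (\<Sum>m\<in>UNIV. ip Q (d m) (mat_app Q (l m) (d m)))"
    by (intro sum_nonneg l)
  moreover have "0 < (\<Sum>m\<in>UNIV. ip Q (d m) (L m))"
  proof -
    have nn: "0 \<le> d m x * L m x" if "x \<in> Q" for m x
      using ln_diff_mult_pos[of "c m x" "c' m x"] sol sol' that
      unfolding discrete_solution_def d_def L_def by (cases "c m x = c' m x") (auto simp: less_imp_le)
    \<comment> \<open>The point where the two solutions differ contributes strictly; everywhere else
      the sign suffices.\<close>
    have "0 < d m x * L m x"
      using ln_diff_mult_pos[of "c m x" "c' m x"] sol sol' x neq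
      unfolding discrete_solution_def d_def L_def by auto
    then have "0 < ip Q (d m) (L m)"
      unfolding ip_def using fin x nn by (intro sum_pos2[of Q x]) auto
    then show ?thesis
      using nn by (intro sum_pos2[of UNIV m]) (auto simp: ip_def intro!: sum_nonneg)
  qed
  ultimately show False by linarith
qed

section \<open>Periodic grid functions\<close>

lemma C_perD: "v \<in> C_per N \<Longrightarrow> v (i + \<alpha> * int N) (j + \<beta> * int N) (k + \<gamma> * int N) = v i j k"
  unfolding C_per_def by (metis (mono_tags, lifting) mem_Collect_eq)

lemma C_per_const: "(\<lambda>_ _ _. r) \<in> C_per N"
  by (simp add: C_per_def)

lemma C_per_comp: "v \<in> C_per N \<Longrightarrow> (\<lambda>i j k. F (v i j k)) \<in> C_per N"
  unfolding C_per_def by auto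

lemma C_per_comp2:
  "v \<in> C_per N \<Longrightarrow> w \<in> C_per N \<Longrightarrow> (\<lambda>i j k. F (v i j k) (w i j k)) \<in> C_per N"
  unfolding C_per_def by auto

lemma C_per_sum: "(\<And>n. n \<in> A \<Longrightarrow> v n \<in> C_per N) \<Longrightarrow> (\<lambda>i j k. \<Sum>n\<in>A. v n i j k) \<in> C_per N"
  unfolding C_per_def by (auto intro!: sum.cong)

lemma C_per_shift:
  assumes "v \<in> C_per N"
  shows "(\<lambda>i j k. v (i + s) (j + t) (k + r)) \<in> C_per N"
  unfolding C_per_def
proof (intro CollectI allI)
  fix i j k \<alpha> \<beta> \<gamma>
  show "v (i + s) (j + t) (k + r) = v (i + \<alpha> * int N + s) (j + \<beta> * int N + t) (k + \<gamma> * int N + r)"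
    using C_perD[OF assms, of "i + s" \<alpha> "j + t" \<beta> "k + r" \<gamma>] by (simp add: add_ac)
qed

lemma D_C_per:
  assumes "v \<in> C_per N"
  shows "D_x h v \<in> C_per N" "D_y h v \<in> C_per N" "D_z h v \<in> C_per N"
    "d_x h v \<in> C_per N" "d_y h v \<in> C_per N" "d_z h v \<in> C_per N"
    "A_x v \<in> C_per N" "A_y v \<in> C_per N" "A_z v \<in> C_per N"
  unfolding D_x_def[abs_def] D_y_def[abs_def] D_z_def[abs_def] d_x_def[abs_def] d_y_def[abs_def]
    d_z_def[abs_def] A_x_def[abs_def] A_y_def[abs_def] A_z_def[abs_def]
  using C_per_comp2[OF C_per_shift[OF assms, of 1 0 0] assms, of "\<lambda>a b. (a - b) / h"]
    C_per_comp2[OF C_per_shift[OF assms, of 0 1 0] assms, of "\<lambda>a b. (a - b) / h"]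
    C_per_comp2[OF C_per_shift[OF assms, of 0 0 1] assms, of "\<lambda>a b. (a - b) / h"]
    C_per_comp2[OF assms C_per_shift[OF assms, of "-1" 0 0], of "\<lambda>a b. (a - b) / h"]
    C_per_comp2[OF assms C_per_shift[OF assms, of 0 "-1" 0], of "\<lambda>a b. (a - b) / h"]
    C_per_comp2[OF assms C_per_shift[OF assms, of 0 0 "-1"], of "\<lambda>a b. (a - b) / h"]
    C_per_comp2[OF C_per_shift[OF assms, of 1 0 0] assms, of "\<lambda>a b. (a + b) / 2"]
    C_per_comp2[OF C_per_shift[OF assms, of 0 1 0] assms, of "\<lambda>a b. (a + b) / 2"]
    C_per_comp2[OF C_per_shift[OF assms, of 0 0 1] assms, of "\<lambda>a b. (a + b) / 2"]
  by simp_all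

lemma div_grad_C_per:
  assumes "p \<in> C_per N" "q \<in> C_per N" "r \<in> C_per N" "v \<in> C_per N"
  shows "div_grad h p q r v \<in> C_per N"
  unfolding div_grad_def[abs_def]
  by (intro C_per_comp2[where F = "(+)"] D_C_per C_per_comp2[where F = "(*)"] assms)

section \<open>One period and its periodic extension\<close>

text \<open>\<open>mod\<close> has representatives from \<open>0\<close> to \<open>N - 1\<close>,
  while the period of the scheme runs from \<open>1\<close> to \<open>N\<close>; hence the shift by
  one before and after.\<close>

definition wrap :: "nat \<Rightarrow> int \<Rightarrow> int" where
  "wrap N i = (i - 1) mod int N + 1"

definition extend :: "nat \<Rightarrow> (int \<times> int \<times> int \<Rightarrow> real) \<Rightarrow> grid" where
  "extend N u i j k = u (wrap N i, wrap N j, wrap N k)"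

text \<open>Triples as indices make a grid function a vector over one index set, as the matrix
  lemmas require. Together with \<open>extend\<close> it translates between periodic functions and
  vectors on one period.\<close>

definition cell :: "grid \<Rightarrow> int \<times> int \<times> int \<Rightarrow> real" where
  "cell v = (\<lambda>(i, j, k). v i j k)"

definition grid_box :: "nat \<Rightarrow> (int \<times> int \<times> int) set" where
  "grid_box N = {1..int N} \<times> {1..int N} \<times> {1..int N}"

lemma cell_apply [simp]: "cell v (i, j, k) = v i j k"
  by (simp add: cell_def)

lemma finite_grid_box [simp]: "finite (grid_box N)"
  by (simp add: grid_box_def)

lemma wrap_bounds: "N \<ge> 1 \<Longrightarrow> wrap N i \<in> {1..int N}"
  using pos_mod_bound[of "int N" "i - 1"] pos_mod_sign[of "int N" "i - 1"]
  unfolding wrap_def atLeastAtMost_iff by linarith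

lemma wrap_id: "i \<in> {1..int N} \<Longrightarrow> wrap N i = i"
  by (simp add: wrap_def)

lemma wrap_in_box: "N \<ge> 1 \<Longrightarrow> (wrap N i, wrap N j, wrap N k) \<in> grid_box N"
  using wrap_bounds by (simp add: grid_box_def)

lemma C_per_wrap:
  assumes "v \<in> C_per N"
  shows "v (wrap N i) (wrap N j) (wrap N k) = v i j k"
proof -
  have w: "wrap N i = i + (- ((i - 1) div int N)) * int N" for i
    unfolding wrap_def minus_div_mult_eq_mod[symmetric] by simp
  show ?thesis
    unfolding w by (rule C_perD[OF assms])
qed

lemma extend_C_per: "extend N u \<in> C_per N"
proof -
  have "wrap N (i + \<alpha> * int N) = wrap N i" for i \<alpha>
    using mod_mult_self1[of "i - 1" \<alpha> "int N"] by (simp add: wrap_def add.commute add_diff_eq diff_add_eq)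
  then show ?thesis
    by (simp add: C_per_def extend_def)
qed

lemma cell_extend: "x \<in> grid_box N \<Longrightarrow> cell (extend N u) x = u x"
  by (auto simp: grid_box_def extend_def wrap_id)

lemma extend_cell: "v \<in> C_per N \<Longrightarrow> extend N (cell v) = v"
  by (intro ext) (simp add: extend_def C_per_wrap)

lemma C_per_all_iff:
  assumes "N \<ge> 1" "v \<in> C_per N"
  shows "(\<forall>i j k. P (v i j k)) \<longleftrightarrow> (\<forall>x\<in>grid_box N. P (cell v x))"
proof
  assume *: "\<forall>x\<in>grid_box N. P (cell v x)"
  show "\<forall>i j k. P (v i j k)"
    using *[rule_format, OF wrap_in_box[OF assms(1)]] by (simp add: C_per_wrap[OF assms(2)])
qed (auto simp: grid_box_def)

lemma C_per_eq_iff: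
  assumes "N \<ge> 1" "v \<in> C_per N" "w \<in> C_per N"
  shows "(\<forall>i j k. v i j k = w i j k) \<longleftrightarrow> (\<forall>x\<in>grid_box N. cell v x = cell w x)"
proof
  assume *: "\<forall>x\<in>grid_box N. cell v x = cell w x"
  show "\<forall>i j k. v i j k = w i j k"
    using *[rule_format, OF wrap_in_box[OF assms(1)]]
    by (simp add: C_per_wrap[OF assms(2)] C_per_wrap[OF assms(3)])
qed (auto simp: grid_box_def)

section \<open>Summation by parts and the Dirichlet form\<close>

definition gsum :: "nat \<Rightarrow> grid \<Rightarrow> real" where
  "gsum N v = (\<Sum>i=1..int N. \<Sum>j=1..int N. \<Sum>k=1..int N. v i j k)"

lemma sum_grid_box: "(\<Sum>x\<in>grid_box N. cell v x) = gsum N v"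
  by (simp add: grid_box_def gsum_def cell_def sum.cartesian_product case_prod_beta')

text \<open>The shifted window from \<open>0\<close> to \<open>N - 1\<close> only trades index
  \<open>N\<close> for index \<open>0\<close>, where a periodic \<open>f\<close> takes the same
  value.\<close>

lemma sum_periodic_shift:
  fixes f :: "int \<Rightarrow> real"
  assumes "\<And>i. f (i + int N) = f i"
  shows "(\<Sum>i=1..int N. f (i - 1)) = (\<Sum>i=1..int N. f i)"
proof (cases "N = 0")
  case False
  have "(\<Sum>i=1..int N. f (i - 1)) = (\<Sum>i=0..int N - 1. f i)"
    by (rule sum.reindex_bij_witness[of _ "\<lambda>i. i + 1" "\<lambda>i. i - 1"]) auto
  also have "{0..int N - 1} = insert 0 {1..int N - 1}" using False by auto
  also have "(\<Sum>i\<in>insert 0 {1..int N - 1}. f i) = f (int N) + (\<Sum>i=1..int N - 1. f i)"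
    using assms[of 0] by simp
  also have "\<dots> = (\<Sum>i\<in>insert (int N) {1..int N - 1}. f i)" by simp
  also have "insert (int N) {1..int N - 1} = {1..int N}" using False by auto
  finally show ?thesis .
qed simp

lemma gsum_shift:
  assumes "g \<in> C_per N"
  shows "gsum N (\<lambda>i j k. g (i - 1) j k) = gsum N g"
    and "gsum N (\<lambda>i j k. g i (j - 1) k) = gsum N g"
    and "gsum N (\<lambda>i j k. g i j (k - 1)) = gsum N g"
proof -
  have p: "g (i + int N) j k = g i j k" "g i (j + int N) k = g i j k" "g i j (k + int N) = g i j k" for i j k
    using C_perD[OF assms, of i 1 j 0 k 0] C_perD[OF assms, of i 0 j 1 k 0] C_perD[OF assms, of i 0 j 0 k 1]
    by simp_all
  show "gsum N (\<lambda>i j k. g (i - 1) j k) = gsum N g"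
    unfolding gsum_def by (rule sum_periodic_shift[of "\<lambda>i. \<Sum>j=1..int N. \<Sum>k=1..int N. g i j k"]) (simp add: p)
  have "(\<Sum>j=1..int N. \<Sum>k=1..int N. g i (j - 1) k) = (\<Sum>j=1..int N. \<Sum>k=1..int N. g i j k)" for i
    by (rule sum_periodic_shift[of "\<lambda>j. \<Sum>k=1..int N. g i j k"]) (simp add: p)
  then show "gsum N (\<lambda>i j k. g i (j - 1) k) = gsum N g"
    by (simp add: gsum_def)
  have "(\<Sum>k=1..int N. g i j (k - 1)) = (\<Sum>k=1..int N. g i j k)" for i j
    by (rule sum_periodic_shift) (simp add: p)
  then show "gsum N (\<lambda>i j k. g i j (k - 1)) = gsum N g"
    by (simp add: gsum_def)
qed

lemma gsum_linear:
  "gsum N (\<lambda>i j k. v i j k + w i j k) = gsum N v + gsum N w"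
  "gsum N (\<lambda>i j k. v i j k - w i j k) = gsum N v - gsum N w"
  "gsum N (\<lambda>i j k. - v i j k) = - gsum N v"
  "gsum N (\<lambda>i j k. v i j k / s) = gsum N v / s"
  by (simp_all add: gsum_def sum.distrib sum_subtractf sum_negf sum_divide_distrib)

text \<open>By the discrete product rule the two summands in the \<open>x\<close>-direction add up
  to a backward difference of \<open>u (i + 1) j k * F i j k\<close>, and likewise in the other
  directions. Such a difference of a periodic function sums to zero over a period.\<close>

lemma summation_by_parts:
  assumes "u \<in> C_per N" "F \<in> C_per N"
  shows "gsum N (\<lambda>i j k. u i j k * d_x h F i j k) = - gsum N (\<lambda>i j k. F i j k * D_x h u i j k)"
    and "gsum N (\<lambda>i j k. u i j k * d_y h F i j k) = - gsum N (\<lambda>i j k. F i j k * D_y h u i j k)"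
    and "gsum N (\<lambda>i j k. u i j k * d_z h F i j k) = - gsum N (\<lambda>i j k. F i j k * D_z h u i j k)"
proof -
  let ?x = "\<lambda>i j k. u (i + 1) j k * F i j k" and ?y = "\<lambda>i j k. u i (j + 1) k * F i j k"
    and ?z = "\<lambda>i j k. u i j (k + 1) * F i j k"
  have per: "?x \<in> C_per N" "?y \<in> C_per N" "?z \<in> C_per N"
    using C_per_comp2[OF C_per_shift[OF assms(1), of 1 0 0] assms(2), of "(*)"]
      C_per_comp2[OF C_per_shift[OF assms(1), of 0 1 0] assms(2), of "(*)"]
      C_per_comp2[OF C_per_shift[OF assms(1), of 0 0 1] assms(2), of "(*)"]
    by simp_all
  have "gsum N (\<lambda>i j k. u i j k * d_x h F i j k) + gsum N (\<lambda>i j k. F i j k * D_x h u i j k)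
      = gsum N (\<lambda>i j k. (?x i j k - ?x (i - 1) j k) / h)"
    unfolding gsum_linear(1)[symmetric]
    by (rule arg_cong[where f = "gsum N"], intro ext) (simp add: d_x_def D_x_def diff_divide_distrib algebra_simps)
  then show "gsum N (\<lambda>i j k. u i j k * d_x h F i j k) = - gsum N (\<lambda>i j k. F i j k * D_x h u i j k)"
    by (simp only: gsum_linear gsum_shift(1)[OF per(1)]) simp
  have "gsum N (\<lambda>i j k. u i j k * d_y h F i j k) + gsum N (\<lambda>i j k. F i j k * D_y h u i j k)
      = gsum N (\<lambda>i j k. (?y i j k - ?y i (j - 1) k) / h)"
    unfolding gsum_linear(1)[symmetric]
    by (rule arg_cong[where f = "gsum N"], intro ext) (simp add: d_y_def D_y_def diff_divide_distrib algebra_simps)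
  then show "gsum N (\<lambda>i j k. u i j k * d_y h F i j k) = - gsum N (\<lambda>i j k. F i j k * D_y h u i j k)"
    by (simp only: gsum_linear gsum_shift(2)[OF per(2)]) simp
  have "gsum N (\<lambda>i j k. u i j k * d_z h F i j k) + gsum N (\<lambda>i j k. F i j k * D_z h u i j k)
      = gsum N (\<lambda>i j k. (?z i j k - ?z i j (k - 1)) / h)"
    unfolding gsum_linear(1)[symmetric]
    by (rule arg_cong[where f = "gsum N"], intro ext) (simp add: d_z_def D_z_def diff_divide_distrib algebra_simps)
  then show "gsum N (\<lambda>i j k. u i j k * d_z h F i j k) = - gsum N (\<lambda>i j k. F i j k * D_z h u i j k)"
    by (simp only: gsum_linear gsum_shift(3)[OF per(3)]) simp
qed

text \<open>The density of the Dirichlet form. Its symmetry in \<open>u\<close> and \<open>v\<close>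
  and, for nonnegative coefficients, its sign at \<open>u = v\<close> are visible, and the matrix of
  the operator inherits both.\<close>

definition energy :: "real \<Rightarrow> grid \<Rightarrow> grid \<Rightarrow> grid \<Rightarrow> grid \<Rightarrow> grid \<Rightarrow> grid" where
  "energy h p q r u v i j k = p i j k * D_x h u i j k * D_x h v i j k
     + q i j k * D_y h u i j k * D_y h v i j k + r i j k * D_z h u i j k * D_z h v i j k"

lemma gsum_mult_div_grad:
  assumes "p \<in> C_per N" "q \<in> C_per N" "r \<in> C_per N" "u \<in> C_per N" "v \<in> C_per N"
  shows "gsum N (\<lambda>i j k. u i j k * - div_grad h p q r v i j k) = gsum N (energy h p q r u v)"
proof -
  note F = C_per_comp2[OF _ D_C_per(1)[OF assms(5)], of _ "(*)"] C_per_comp2[OF _ D_C_per(2)[OF assms(5)], of _ "(*)"]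
    C_per_comp2[OF _ D_C_per(3)[OF assms(5)], of _ "(*)"]
  define X where "X i j k = u i j k * d_x h (\<lambda>i j k. p i j k * D_x h v i j k) i j k" for i j k
  define Y where "Y i j k = u i j k * d_y h (\<lambda>i j k. q i j k * D_y h v i j k) i j k" for i j k
  define Z where "Z i j k = u i j k * d_z h (\<lambda>i j k. r i j k * D_z h v i j k) i j k" for i j k
  have XYZ: "gsum N X = - gsum N (\<lambda>i j k. p i j k * D_x h v i j k * D_x h u i j k)"
    "gsum N Y = - gsum N (\<lambda>i j k. q i j k * D_y h v i j k * D_y h u i j k)"
    "gsum N Z = - gsum N (\<lambda>i j k. r i j k * D_z h v i j k * D_z h u i j k)"
    unfolding X_def[abs_def] Y_def[abs_def] Z_def[abs_def]
    by (intro summation_by_parts assms F)+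
  have "(\<lambda>i j k. u i j k * - div_grad h p q r v i j k) = (\<lambda>i j k. - X i j k - Y i j k - Z i j k)"
    by (intro ext) (simp add: X_def Y_def Z_def div_grad_def algebra_simps)
  then have "gsum N (\<lambda>i j k. u i j k * - div_grad h p q r v i j k) = - gsum N X - gsum N Y - gsum N Z"
    by (simp only: gsum_linear)
  also have "\<dots> = gsum N (\<lambda>i j k. p i j k * D_x h v i j k * D_x h u i j k
      + q i j k * D_y h v i j k * D_y h u i j k + r i j k * D_z h v i j k * D_z h u i j k)"
    unfolding XYZ gsum_linear by simp
  also have "\<dots> = gsum N (energy h p q r u v)"
    by (rule arg_cong[where f = "gsum N"], intro ext) (simp add: energy_def)
  finally show ?thesis .
qed

lemma div_grad_linear:
  "div_grad h p q r (\<lambda>i j k. 0) i j k = 0"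
  "div_grad h p q r (\<lambda>i j k. s * u i j k + v i j k) i j k
    = s * div_grad h p q r u i j k + div_grad h p q r v i j k"
  by (simp_all add: div_grad_def d_x_def d_y_def d_z_def D_x_def D_y_def D_z_def
      add_divide_distrib diff_divide_distrib algebra_simps)

lemma div_grad_sum:
  assumes "finite A"
  shows "div_grad h p q r (\<lambda>i j k. \<Sum>y\<in>A. w y * e y i j k) i j k
    = (\<Sum>y\<in>A. w y * div_grad h p q r (e y) i j k)"
  using assms by induction (simp_all add: div_grad_linear)

section \<open>The matrix of the divergence-form operator\<close>

text \<open>Column \<open>y\<close> is the negated operator applied to the periodic point mass at
  \<open>y\<close>; the minus sign makes the matrix positive semidefinite for nonnegative
  coefficients.\<close>

definition div_grad_mat ::
  "nat \<Rightarrow> real \<Rightarrow> grid \<Rightarrow> grid \<Rightarrow> grid \<Rightarrow> int \<times> int \<times> int \<Rightarrow> int \<times> int \<times> int \<Rightarrow> real" where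
  "div_grad_mat N h p q r x y = - cell (div_grad h p q r (extend N (\<lambda>x. of_bool (x = y)))) x"

text \<open>A periodic function is the combination of the periodic point masses with its own values
  as coefficients, so linearity reduces the claim to the columns.\<close>

lemma mat_app_div_grad:
  assumes "N \<ge> 1" "v \<in> C_per N"
  shows "mat_app (grid_box N) (div_grad_mat N h p q r) (cell v) x = - cell (div_grad h p q r v) x"
proof -
  obtain i j k where x: "x = (i, j, k)" by (cases x) auto
  have "v = (\<lambda>i j k. \<Sum>y\<in>grid_box N. cell v y * extend N (\<lambda>x. of_bool (x = y)) i j k)"
  proof (intro ext)
    fix i j k
    let ?w = "(wrap N i, wrap N j, wrap N k)"
    have "(\<Sum>y\<in>grid_box N. cell v y * of_bool (?w = y)) = (\<Sum>y\<in>{?w}. cell v y * of_bool (?w = y))"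
      using wrap_in_box[OF assms(1)] by (intro sum.mono_neutral_right) auto
    then show "v i j k = (\<Sum>y\<in>grid_box N. cell v y * extend N (\<lambda>x. of_bool (x = y)) i j k)"
      by (simp add: extend_def C_per_wrap[OF assms(2)])
  qed
  then have "div_grad h p q r v i j k
      = div_grad h p q r (\<lambda>i j k. \<Sum>y\<in>grid_box N. cell v y * extend N (\<lambda>x. of_bool (x = y)) i j k) i j k"
    by (rule arg_cong)
  then show ?thesis
    by (simp add: x div_grad_sum mat_app_def div_grad_mat_def sum_negf mult.commute)
qed

lemma mat_app_cong: "(\<And>x. x \<in> Q \<Longrightarrow> u x = v x) \<Longrightarrow> mat_app Q a u x = mat_app Q a v x"
  by (simp add: mat_app_def)

lemma ip_div_grad_mat:
  assumes "N \<ge> 1" "p \<in> C_per N" "q \<in> C_per N" "r \<in> C_per N"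
  shows "ip (grid_box N) u (mat_app (grid_box N) (div_grad_mat N h p q r) v)
    = gsum N (energy h p q r (extend N u) (extend N v))"
proof -
  have app: "mat_app (grid_box N) (div_grad_mat N h p q r) v x = - cell (div_grad h p q r (extend N v)) x" for x
  proof -
    have "mat_app (grid_box N) (div_grad_mat N h p q r) v x
        = mat_app (grid_box N) (div_grad_mat N h p q r) (cell (extend N v)) x"
      by (rule mat_app_cong) (simp add: cell_extend)
    then show ?thesis
      by (simp only: mat_app_div_grad[OF assms(1) extend_C_per])
  qed
  have "ip (grid_box N) u (mat_app (grid_box N) (div_grad_mat N h p q r) v)
      = (\<Sum>x\<in>grid_box N. cell (\<lambda>i j k. extend N u i j k * - div_grad h p q r (extend N v) i j k) x)"
    unfolding ip_def
  proof (rule sum.cong[OF refl])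
    fix x assume "x \<in> grid_box N"
    from cell_extend[OF this, of u] app[of x]
    show "u x * mat_app (grid_box N) (div_grad_mat N h p q r) v x
      = cell (\<lambda>i j k. extend N u i j k * - div_grad h p q r (extend N v) i j k) x"
      by (cases x) simp
  qed
  also have "\<dots> = gsum N (energy h p q r (extend N u) (extend N v))"
    unfolding sum_grid_box by (intro gsum_mult_div_grad assms extend_C_per)
  finally show ?thesis .
qed

lemma sym_div_grad_mat:
  assumes "N \<ge> 1" "p \<in> C_per N" "q \<in> C_per N" "r \<in> C_per N" "x \<in> grid_box N" "y \<in> grid_box N"
  shows "div_grad_mat N h p q r x y = div_grad_mat N h p q r y x"
proof -
  \<comment> \<open>Indicators of single points read off the matrix entries from the bilinear form,
    whose expression through \<open>energy\<close> is symmetric.\<close>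
  let ?I = "\<lambda>y x. of_bool (x = y) :: real"
  have ind: "div_grad_mat N h p q r x y = ip (grid_box N) (?I x) (mat_app (grid_box N) (div_grad_mat N h p q r) (?I y))"
    if "x \<in> grid_box N" "y \<in> grid_box N" for x y
    using that by (simp add: ip_def mat_app_def of_bool_def if_distrib if_distribR cong: if_cong)
  show ?thesis
    unfolding ind[OF assms(5,6)] ind[OF assms(6,5)] ip_div_grad_mat[OF assms(1-4)]
    by (simp add: energy_def[abs_def] mult_ac)
qed

lemma psd_div_grad_mat:
  assumes "N \<ge> 1" "p \<in> C_per N" "q \<in> C_per N" "r \<in> C_per N"
    and "\<And>i j k. p i j k \<ge> 0" "\<And>i j k. q i j k \<ge> 0" "\<And>i j k. r i j k \<ge> 0"
  shows "0 \<le> ip (grid_box N) u (mat_app (grid_box N) (div_grad_mat N h p q r) u)"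
  unfolding ip_div_grad_mat[OF assms(1-4)] gsum_def energy_def
  by (intro sum_nonneg add_nonneg_nonneg) (simp_all add: assms mult.assoc)

lemma int_shift_invariant_const:
  assumes "\<And>i::int. f (i + 1) = f i"
  shows "f i = f j"
proof -
  have "f i = f 0" for i
  proof (induction i rule: int_induct[of _ 0])
    case (step1 i) then show ?case using assms[of i] by simp
  next
    case (step2 i) then show ?case using assms[of "i - 1"] by simp
  qed simp
  then show ?thesis by metis
qed

text \<open>Since the coefficients are positive, zero energy forces the differences in all three
  directions to vanish; unit steps along the axes connect the grid, so only constants remain in the
  kernel.\<close>

lemma laplacian_like_div_grad_mat:
  assumes N: "N \<ge> 1" and h: "h \<noteq> 0" and per: "p \<in> C_per N" "q \<in> C_per N" "r \<in> C_per N"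
    and pos: "\<And>i j k. p i j k > 0" "\<And>i j k. q i j k > 0" "\<And>i j k. r i j k > 0"
  shows "laplacian_like (grid_box N) (div_grad_mat N h p q r)"
  unfolding laplacian_like_def
proof (intro conjI ballI allI impI)
  fix x y assume "x \<in> grid_box N" "y \<in> grid_box N"
  then show "div_grad_mat N h p q r x y = div_grad_mat N h p q r y x"
    by (rule sym_div_grad_mat[OF N per])
next
  fix x :: "int \<times> int \<times> int"
  \<comment> \<open>Row sums are the matrix applied to the constant \<open>1\<close>, whose
    differences vanish.\<close>
  have "mat_app (grid_box N) (div_grad_mat N h p q r) (cell (\<lambda>_ _ _. 1)) x = 0"
    unfolding mat_app_div_grad[OF N C_per_const]
    by (simp add: cell_def div_grad_def d_x_def d_y_def d_z_def D_x_def D_y_def D_z_def case_prod_beta')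
  then show "(\<Sum>y\<in>grid_box N. div_grad_mat N h p q r x y) = 0"
    by (simp add: mat_app_def cell_def case_prod_beta')
next
  fix u
  show "0 \<le> ip (grid_box N) u (mat_app (grid_box N) (div_grad_mat N h p q r) u)"
    by (intro psd_div_grad_mat N per less_imp_le pos)
next
  fix u x y
  assume 0: "ip (grid_box N) u (mat_app (grid_box N) (div_grad_mat N h p q r) u) = 0"
    and x: "x \<in> grid_box N" and y: "y \<in> grid_box N"
  let ?e = "energy h p q r (extend N u) (extend N u)" and ?v = "extend N u"
  have nn: "0 \<le> p i j k * (D_x h ?v i j k)\<^sup>2" "0 \<le> q i j k * (D_y h ?v i j k)\<^sup>2" "0 \<le> r i j k * (D_z h ?v i j k)\<^sup>2" for i j k
    using pos by (simp_all add: less_imp_le)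
  have e: "?e i j k = p i j k * (D_x h ?v i j k)\<^sup>2 + q i j k * (D_y h ?v i j k)\<^sup>2 + r i j k * (D_z h ?v i j k)\<^sup>2" for i j k
    by (simp add: energy_def power2_eq_square mult.assoc)
  have e_nn: "0 \<le> cell ?e x" for x
    using nn by (cases x) (simp add: e add_nonneg_nonneg)
  have "(\<Sum>x\<in>grid_box N. cell ?e x) = 0"
    using 0 unfolding ip_div_grad_mat[OF N per] sum_grid_box .
  then have "\<forall>x\<in>grid_box N. cell ?e x = 0"
    using sum_nonneg_eq_0_iff[OF finite_grid_box, of N "cell ?e"] e_nn by blast
  moreover have "?e \<in> C_per N"
    unfolding energy_def[abs_def]
    by (intro C_per_comp2[where F = "(+)"] C_per_comp2[where F = "(*)"] per D_C_per extend_C_per)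
  \<comment> \<open>Periodicity spreads the vanishing of the energy from the box to all indices, so
    that steps across the boundary of the period are covered too.\<close>
  ultimately have e0: "?e i j k = 0" for i j k
    using C_per_all_iff[OF N, of ?e "\<lambda>t. t = 0"] by blast
  have "D_x h ?v i j k = 0 \<and> D_y h ?v i j k = 0 \<and> D_z h ?v i j k = 0" for i j k
  proof -
    have "p i j k * (D_x h ?v i j k)\<^sup>2 = 0" "q i j k * (D_y h ?v i j k)\<^sup>2 = 0" "r i j k * (D_z h ?v i j k)\<^sup>2 = 0"
      using nn[of i j k] e0[of i j k] unfolding e by linarith+
    then show ?thesis
      using pos[of i j k] by simp
  qed
  then have *: "?v (i + 1) j k = ?v i j k" "?v i (j + 1) k = ?v i j k" "?v i j (k + 1) = ?v i j k" for i j k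
    using h by (simp_all add: D_x_def D_y_def D_z_def)
  have "?v i j k = ?v i' j' k'" for i j k i' j' k'
    using int_shift_invariant_const[of "\<lambda>i. ?v i j k", OF *(1), of i i']
      int_shift_invariant_const[of "\<lambda>j. ?v i' j k", OF *(2), of j j']
      int_shift_invariant_const[of "\<lambda>k. ?v i' j' k", OF *(3), of k k'] by simp
  then have "cell ?v x = cell ?v y"
    by (cases x; cases y) simp
  then show "u x = u y"
    using x y by (simp add: cell_extend)
qed

section \<open>The scheme\<close>

text \<open>Only values on \<open>Q\<close> enter the equations; this allows a discrete solution to
  be replaced by its periodic extension, which may change it off \<open>Q\<close>.\<close>

lemma discrete_solution_cong:
  assumes "\<And>m x. x \<in> Q \<Longrightarrow> c m x = c' m x" "\<And>m x. x \<in> Q \<Longrightarrow> \<mu> m x = \<mu>' m x"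
    and "\<And>x. x \<in> Q \<Longrightarrow> \<psi> x = \<psi>' x"
  shows "discrete_solution Q a k l gc z \<tau> f \<rho> c\<^sub>0 c \<mu> \<psi> \<longleftrightarrow> discrete_solution Q a k l gc z \<tau> f \<rho> c\<^sub>0 c' \<mu>' \<psi>'"
proof -
  have m: "mat_app Q a (c m) x = mat_app Q a (c' m) x" "mat_app Q a (\<mu> m) x = mat_app Q a (\<mu>' m) x"
    "mat_app Q a \<psi> x = mat_app Q a \<psi>' x" for a m x
    by (rule mat_app_cong, simp add: assms)+
  have "(\<Sum>x\<in>Q. \<psi> x) = (\<Sum>x\<in>Q. \<psi>' x)"
    by (rule sum.cong) (simp_all add: assms)
  then show ?thesis
    unfolding discrete_solution_def m by (simp add: assms)
qed

text \<open>Both sides of each equation of the scheme are periodic, so each needs checking on one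
  period only, where it becomes the matching matrix equation.\<close>

lemma scheme_solution_iff:
  fixes c\<^sub>0 c \<mu> :: "'m::finite \<Rightarrow> grid"
  assumes ab: "a < b" and N: "N \<ge> 1" and dt: "\<Delta>t > 0"
    and \<kappa>: "\<kappa>x \<in> C_per N" "\<kappa>y \<in> C_per N" "\<kappa>z \<in> C_per N"
    and \<rho>: "\<rho> \<in> C_per N" and c\<^sub>0: "\<And>m. c\<^sub>0 m \<in> C_per N"
    and c: "\<And>m. c m \<in> C_per N" and \<mu>: "\<And>m. \<mu> m \<in> C_per N" and \<psi>: "\<psi> \<in> C_per N"
    and h: "h = mesh_size a b N"
  shows "scheme_solution a b N \<Delta>t z \<epsilon> \<sigma> \<kappa>x \<kappa>y \<kappa>z Gc Ge \<rho> c\<^sub>0 c \<mu> \<psi> \<longleftrightarrow>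
    discrete_solution (grid_box N)
      (\<lambda>m. div_grad_mat N h (A_x (c\<^sub>0 m)) (A_y (c\<^sub>0 m)) (A_z (c\<^sub>0 m)))
      (div_grad_mat N h \<kappa>x \<kappa>y \<kappa>z)
      (\<lambda>m x y. \<sigma> m * div_grad_mat N h (\<lambda>_ _ _. 1) (\<lambda>_ _ _. 1) (\<lambda>_ _ _. 1) x y)
      (\<lambda>m n. Gc $ m $ n) z (\<lambda>m. \<Delta>t * \<epsilon> m) (\<lambda>m x. \<Sum>n\<in>UNIV. Ge $ m $ n * cell (c\<^sub>0 n) x)
      (cell \<rho>) (\<lambda>m. cell (c\<^sub>0 m)) (\<lambda>m. cell (c m)) (\<lambda>m. cell (\<mu> m)) (cell \<psi>)"
proof -
  have pos: "(\<forall>i j k. c m i j k > 0) \<longleftrightarrow> (\<forall>x\<in>grid_box N. cell (c m) x > 0)" for m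
    by (rule C_per_all_iff[OF N c])
  have mean: "grid_avg a b N \<psi> = 0 \<longleftrightarrow> (\<Sum>x\<in>grid_box N. cell \<psi> x) = 0"
    using ab N by (simp add: grid_avg_def mesh_size_def sum_grid_box gsum_def)
  let ?a = "\<lambda>m. div_grad h (A_x (c\<^sub>0 m)) (A_y (c\<^sub>0 m)) (A_z (c\<^sub>0 m)) (\<mu> m)"
  have "(\<forall>i j k. (c m i j k - c\<^sub>0 m i j k) / \<Delta>t = \<epsilon> m * ?a m i j k) \<longleftrightarrow>
      (\<forall>x\<in>grid_box N. cell (\<lambda>i j k. (c m i j k - c\<^sub>0 m i j k) / \<Delta>t) x = cell (\<lambda>i j k. \<epsilon> m * ?a m i j k) x)" for m
    by (intro C_per_eq_iff N C_per_comp[where F = "\<lambda>t. t / \<Delta>t"] C_per_comp2[where F = "(-)"]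
        C_per_comp[where F = "(*) (\<epsilon> m)"] div_grad_C_per D_C_per c c\<^sub>0 \<mu>)
  moreover have "cell (\<lambda>i j k. (c m i j k - c\<^sub>0 m i j k) / \<Delta>t) x = cell (\<lambda>i j k. \<epsilon> m * ?a m i j k) x
      \<longleftrightarrow> cell (c m) x - cell (c\<^sub>0 m) x = - (\<Delta>t * \<epsilon> m) * mat_app (grid_box N)
        (div_grad_mat N h (A_x (c\<^sub>0 m)) (A_y (c\<^sub>0 m)) (A_z (c\<^sub>0 m))) (cell (\<mu> m)) x" for m x
    unfolding mat_app_div_grad[OF N \<mu>] using dt by (cases x) (simp add: field_simps)
  ultimately have conc: "(\<forall>i j k. (c m i j k - c\<^sub>0 m i j k) / \<Delta>t = \<epsilon> m * ?a m i j k) \<longleftrightarrow>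
      (\<forall>x\<in>grid_box N. cell (c m) x - cell (c\<^sub>0 m) x = - (\<Delta>t * \<epsilon> m) * mat_app (grid_box N)
        (div_grad_mat N h (A_x (c\<^sub>0 m)) (A_y (c\<^sub>0 m)) (A_z (c\<^sub>0 m))) (cell (\<mu> m)) x)" for m
    by simp
  let ?\<mu> = "\<lambda>m i j k. z m * \<psi> i j k + ln (c m i j k) + (\<Sum>n\<in>UNIV. Gc $ m $ n * c n i j k)
      - \<sigma> m * laplace h (c m) i j k - (\<Sum>n\<in>UNIV. Ge $ m $ n * c\<^sub>0 n i j k)"
  have "laplace h (c m) \<in> C_per N" for m
    unfolding laplace_def[abs_def] by (intro div_grad_C_per C_per_const c)
  then have "(\<forall>i j k. \<mu> m i j k = ?\<mu> m i j k) \<longleftrightarrow> (\<forall>x\<in>grid_box N. cell (\<mu> m) x = cell (?\<mu> m) x)" for m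
    by (intro C_per_eq_iff N \<mu> C_per_comp2[where F = "(+)"] C_per_comp2[where F = "(-)"] C_per_sum
        C_per_comp[where F = ln] C_per_comp[where F = "(*) _"] c c\<^sub>0 \<psi>)
  moreover have "cell (?\<mu> m) x = z m * cell \<psi> x + ln (cell (c m) x) + (\<Sum>n\<in>UNIV. Gc $ m $ n * cell (c n) x)
      + mat_app (grid_box N) (\<lambda>x y. \<sigma> m * div_grad_mat N h (\<lambda>_ _ _. 1) (\<lambda>_ _ _. 1) (\<lambda>_ _ _. 1) x y) (cell (c m)) x
      - (\<Sum>n\<in>UNIV. Ge $ m $ n * cell (c\<^sub>0 n) x)" for m x
  proof -
    have "mat_app (grid_box N) (\<lambda>x y. \<sigma> m * div_grad_mat N h (\<lambda>_ _ _. 1) (\<lambda>_ _ _. 1) (\<lambda>_ _ _. 1) x y) (cell (c m)) x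
        = \<sigma> m * mat_app (grid_box N) (div_grad_mat N h (\<lambda>_ _ _. 1) (\<lambda>_ _ _. 1) (\<lambda>_ _ _. 1)) (cell (c m)) x"
      by (simp add: mat_app_def sum_distrib_left mult.assoc)
    also have "\<dots> = - \<sigma> m * cell (laplace h (c m)) x"
      unfolding mat_app_div_grad[OF N c] laplace_def by simp
    finally show ?thesis by (cases x) simp
  qed
  ultimately have pot: "(\<forall>i j k. \<mu> m i j k = ?\<mu> m i j k) \<longleftrightarrow> (\<forall>x\<in>grid_box N. cell (\<mu> m) x =
      z m * cell \<psi> x + ln (cell (c m) x) + (\<Sum>n\<in>UNIV. Gc $ m $ n * cell (c n) x)
      + mat_app (grid_box N) (\<lambda>x y. \<sigma> m * div_grad_mat N h (\<lambda>_ _ _. 1) (\<lambda>_ _ _. 1) (\<lambda>_ _ _. 1) x y) (cell (c m)) x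
      - (\<Sum>n\<in>UNIV. Ge $ m $ n * cell (c\<^sub>0 n) x))" for m
    by simp
  have "(\<forall>i j k. - div_grad h \<kappa>x \<kappa>y \<kappa>z \<psi> i j k = (\<Sum>m\<in>UNIV. z m * c m i j k) + \<rho> i j k) \<longleftrightarrow>
      (\<forall>x\<in>grid_box N. cell (\<lambda>i j k. - div_grad h \<kappa>x \<kappa>y \<kappa>z \<psi> i j k) x
         = cell (\<lambda>i j k. (\<Sum>m\<in>UNIV. z m * c m i j k) + \<rho> i j k) x)"
    by (intro C_per_eq_iff N C_per_comp[where F = uminus] div_grad_C_per C_per_comp2[where F = "(+)"]
        C_per_sum C_per_comp[where F = "(*) _"] \<kappa> \<psi> c \<rho>)
  moreover have "cell (\<lambda>i j k. - div_grad h \<kappa>x \<kappa>y \<kappa>z \<psi> i j k) x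
      = mat_app (grid_box N) (div_grad_mat N h \<kappa>x \<kappa>y \<kappa>z) (cell \<psi>) x"
    "cell (\<lambda>i j k. (\<Sum>m\<in>UNIV. z m * c m i j k) + \<rho> i j k) x
      = (\<Sum>m\<in>UNIV. z m * cell (c m) x) + cell \<rho> x" for x
    unfolding mat_app_div_grad[OF N \<psi>] by (cases x; simp)+
  ultimately have poisson: "(\<forall>i j k. - div_grad h \<kappa>x \<kappa>y \<kappa>z \<psi> i j k = (\<Sum>m\<in>UNIV. z m * c m i j k) + \<rho> i j k) \<longleftrightarrow>
      (\<forall>x\<in>grid_box N. mat_app (grid_box N) (div_grad_mat N h \<kappa>x \<kappa>y \<kappa>z) (cell \<psi>) x
         = (\<Sum>m\<in>UNIV. z m * cell (c m) x) + cell \<rho> x)"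
    by simp
  show ?thesis
    unfolding scheme_solution_def discrete_solution_def Let_def h[symmetric] pos mean conc pot poisson
    using c \<mu> \<psi> by simp
qed

theorem theorem4p2:
  fixes a b \<Delta>t \<kappa>\<^sub>0 M\<^sub>1 :: real
    and N :: nat
    and z \<epsilon> \<sigma> :: "'m::finite \<Rightarrow> real"
    and \<kappa>x \<kappa>y \<kappa>z \<rho> :: grid
    and G Gc Ge :: "real^'m^'m"
    and c\<^sub>0 :: "'m \<Rightarrow> grid"
  assumes "a < b" and "N \<ge> 1" and "\<Delta>t > 0"
    and "\<And>m. \<epsilon> m > 0" and "\<And>m. \<sigma> m > 0"
    and "\<kappa>\<^sub>0 > 0"
    and "\<kappa>x \<in> C_per N" and "\<kappa>y \<in> C_per N" and "\<kappa>z \<in> C_per N"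
    and "\<And>i j k. \<kappa>x i j k \<ge> \<kappa>\<^sub>0" and "\<And>i j k. \<kappa>y i j k \<ge> \<kappa>\<^sub>0" and "\<And>i j k. \<kappa>z i j k \<ge> \<kappa>\<^sub>0"
    and "transpose G = G" and "\<And>m n. G $ m $ n \<ge> 0"
    and "G = Gc - Ge" and "psd_matrix Gc" and "psd_matrix Ge"
    and "\<rho> \<in> C_per N"
    and "\<And>m. c\<^sub>0 m \<in> C_per N" and "\<And>m i j k. c\<^sub>0 m i j k > 0"
    and "M\<^sub>1 > 0" and "\<And>m. grid_max_norm N (c\<^sub>0 m) \<le> M\<^sub>1"
    and "grid_avg a b N \<rho> + (\<Sum>m\<in>UNIV. z m * grid_avg a b N (c\<^sub>0 m)) = 0"
  shows "\<exists>!c. \<exists>\<mu> \<psi>. scheme_solution a b N \<Delta>t z \<epsilon> \<sigma> \<kappa>x \<kappa>y \<kappa>z Gc Ge \<rho> c\<^sub>0 c \<mu> \<psi>"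
proof -
  note N = \<open>N \<ge> 1\<close>
  define h where "h = mesh_size a b N"
  have h: "h \<noteq> 0"
    using assms(1,2) by (simp add: h_def mesh_size_def)
  let ?Q = "grid_box N" and ?one = "\<lambda>_ _ _. 1 :: real"
  let ?a = "\<lambda>m. div_grad_mat N h (A_x (c\<^sub>0 m)) (A_y (c\<^sub>0 m)) (A_z (c\<^sub>0 m))"
  let ?k = "div_grad_mat N h \<kappa>x \<kappa>y \<kappa>z"
  let ?l = "\<lambda>m x y. \<sigma> m * div_grad_mat N h ?one ?one ?one x y"
  let ?gc = "\<lambda>m n. Gc $ m $ n" and ?\<tau> = "\<lambda>m. \<Delta>t * \<epsilon> m"
  let ?S = "discrete_solution ?Q ?a ?k ?l ?gc z ?\<tau> (\<lambda>m x. \<Sum>n\<in>UNIV. Ge $ m $ n * cell (c\<^sub>0 n) x)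
      (cell \<rho>) (\<lambda>m. cell (c\<^sub>0 m))"
  have scheme_iff: "scheme_solution a b N \<Delta>t z \<epsilon> \<sigma> \<kappa>x \<kappa>y \<kappa>z Gc Ge \<rho> c\<^sub>0 c \<mu> \<psi>
      \<longleftrightarrow> ?S (\<lambda>m. cell (c m)) (\<lambda>m. cell (\<mu> m)) (cell \<psi>)"
    if "\<And>m. c m \<in> C_per N" "\<And>m. \<mu> m \<in> C_per N" "\<psi> \<in> C_per N" for c \<mu> \<psi>
    by (rule scheme_solution_iff) (fact assms(1-3,7-9,18,19) that h_def)+
  have \<tau>: "?\<tau> m > 0" for m
    using assms(3,4) by simp
  \<comment> \<open>The mobilities are averages of two positive neighbouring values, hence
    positive.\<close>
  have a: "laplacian_like ?Q (?a m)" for m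
    using assms(20) by (intro laplacian_like_div_grad_mat N h D_C_per assms(19))
      (simp_all add: A_x_def A_y_def A_z_def add_pos_pos)
  have k: "laplacian_like ?Q ?k"
    using assms(6,10-12) by (intro laplacian_like_div_grad_mat N h assms(7-9)) (meson less_le_trans)+
  have l_sym: "?l m x y = ?l m y x" if "x \<in> ?Q" "y \<in> ?Q" for m x y
    using sym_div_grad_mat[OF N C_per_const C_per_const C_per_const that] by simp
  have l_psd: "0 \<le> ip ?Q u (mat_app ?Q (?l m) u)" for m u
  proof -
    have "ip ?Q u (mat_app ?Q (?l m) u) = \<sigma> m * ip ?Q u (mat_app ?Q (div_grad_mat N h ?one ?one ?one) u)"
      by (simp add: ip_def mat_app_def sum_distrib_left mult_ac)
    then show ?thesis
      using psd_div_grad_mat[OF N C_per_const[of 1] C_per_const[of 1] C_per_const[of 1], where h = h and u = u] assms(5)[of m] by simp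
  qed
  have gc_sym: "?gc m n = ?gc n m" for m n
    using assms(16) unfolding psd_matrix_def transpose_def by (metis vec_lambda_beta)
  have gc_psd: "0 \<le> (\<Sum>m\<in>UNIV. u m * (\<Sum>n\<in>UNIV. ?gc m n * u n))" for u
  proof -
    have "0 \<le> (\<chi> m. u m) \<bullet> (Gc *v (\<chi> m. u m))"
      using assms(16) by (simp add: psd_matrix_def)
    then show ?thesis
      by (simp add: inner_vec_def matrix_vector_mult_def)
  qed
  have neutral: "(\<Sum>x\<in>?Q. cell \<rho> x) + (\<Sum>m\<in>UNIV. z m * (\<Sum>x\<in>?Q. cell (c\<^sub>0 m) x)) = 0"
  proof -
    \<comment> \<open>Dividing by this common nonzero weight turns the condition on averages into
      one on sums.\<close>
    define w where "w = mesh_size a b N ^ 3 / (b - a) ^ 3"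
    have "w \<noteq> 0"
      using assms(1,2) by (simp add: w_def mesh_size_def)
    have "grid_avg a b N v = w * gsum N v" for v
      by (simp add: grid_avg_def w_def gsum_def)
    then have "w * (gsum N \<rho> + (\<Sum>m\<in>UNIV. z m * gsum N (c\<^sub>0 m))) = 0"
      using assms(23) by (simp add: distrib_left sum_distrib_left mult_ac)
    then show ?thesis
      using \<open>w \<noteq> 0\<close> by (simp add: sum_grid_box)
  qed
  have ne: "?Q \<noteq> {}" using wrap_in_box[OF N] by blast
  have c\<^sub>0: "cell (c\<^sub>0 m) x > 0" if "x \<in> ?Q" for m x
    using assms(20) by (cases x) simp
  have "\<exists>c \<mu> \<psi>. ?S c \<mu> \<psi>"
    by (rule discrete_solution_exists[OF finite_grid_box ne]) (fact a k l_sym gc_sym \<tau> c\<^sub>0 neutral)+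
  then obtain c \<mu> \<psi> where S: "?S c \<mu> \<psi>"
    by blast
  show ?thesis
  proof (rule ex1I)
    \<comment> \<open>Off the box nothing is known of the discrete solution; its periodic extension
      agrees with it on the box and hence is a discrete solution as well.\<close>
    have "?S (\<lambda>m. cell (extend N (c m))) (\<lambda>m. cell (extend N (\<mu> m))) (cell (extend N \<psi>))"
      by (rule iffD1[OF discrete_solution_cong S]) (simp_all add: cell_extend)
    then have "scheme_solution a b N \<Delta>t z \<epsilon> \<sigma> \<kappa>x \<kappa>y \<kappa>z Gc Ge \<rho> c\<^sub>0
        (\<lambda>m. extend N (c m)) (\<lambda>m. extend N (\<mu> m)) (extend N \<psi>)"
      by (subst scheme_iff) (simp_all only: extend_C_per)
    then show "\<exists>\<mu> \<psi>. scheme_solution a b N \<Delta>t z \<epsilon> \<sigma> \<kappa>x \<kappa>y \<kappa>z Gc Ge \<rho> c\<^sub>0 (\<lambda>m. extend N (c m)) \<mu> \<psi>"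
      by blast
  next
    fix c'
    assume "\<exists>\<mu> \<psi>. scheme_solution a b N \<Delta>t z \<epsilon> \<sigma> \<kappa>x \<kappa>y \<kappa>z Gc Ge \<rho> c\<^sub>0 c' \<mu> \<psi>"
    then obtain \<mu>' \<psi>' where sol: "scheme_solution a b N \<Delta>t z \<epsilon> \<sigma> \<kappa>x \<kappa>y \<kappa>z Gc Ge \<rho> c\<^sub>0 c' \<mu>' \<psi>'"
      by blast
    then have per: "c' m \<in> C_per N" "\<mu>' m \<in> C_per N" "\<psi>' \<in> C_per N" for m
      unfolding scheme_solution_def Let_def by blast+
    have S': "?S (\<lambda>m. cell (c' m)) (\<lambda>m. cell (\<mu>' m)) (cell \<psi>')"
      using sol scheme_iff[of c' \<mu>' \<psi>', OF per] by blast
    have a_psd: "0 \<le> ip ?Q u (mat_app ?Q (?a m) u)" and k_psd: "0 \<le> ip ?Q u (mat_app ?Q ?k u)" for m u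
      using a[of m] k unfolding laplacian_like_def by blast+
    \<comment> \<open>Any solution of the scheme, cut down to the box, agrees there with
      \<open>c\<close>, and a periodic function is recovered from its values on the box.\<close>
    have "c m x = cell (c' m) x" if "x \<in> ?Q" for m x
      by (rule discrete_solution_unique[OF finite_grid_box _ _ _ _ _ S S' that])
        (fact a_psd k_psd l_psd gc_psd \<tau>)+
    then have "extend N (c m) = extend N (cell (c' m))" for m
      by (intro ext) (simp add: extend_def wrap_in_box[OF N])
    then show "c' = (\<lambda>m. extend N (c m))"
      by (simp add: extend_cell[OF per(1)])
  qed
qed

end
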